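(* Let $\theta\ge0$, $\omega\ge0$, $a\ge0$, $b\ge0$ satisfy $b\,\omega^{-1}(e^{a\omega}-1)<1$. Then $(\varphi,f)\mapsto\varphi(\Delta_{\theta,\omega})f$ is a continuous map from $\mathcal L^+_a\times\mathcal L^+_b$ into $\mathcal L^+_c$, where $c=b\,e^{a\omega}\bigl(1-b\,\omega^{-1}(e^{a\omega}-1)\bigr)^{-1}$.
   Context: $D=\partial/\partial z$. $\Delta_{\theta,\omega}=(\theta+\omega z)D+zD^2$, and for entire $\varphi,f$, $\varphi(\Delta_{\theta,\omega})f=\sum_{k\ge0}\frac{\varphi^{(k)}(0)}{k!}\Delta_{\theta,\omega}^kf$. For $b>0$, $\|f\|_b=\sup_{k\in\mathbb N_0}b^{-k}|f^{(k)}(0)|$; for $a\ge0$, $\mathcal A_a$ is the set of entire $f$ with $\|f\|_b<\infty$ for all $b>a$, with the Fréchet topology of these norms. $\mathcal L^+$ is the set of entire functions of the form $f(z)=Cz^m e^{\alpha z}\prod_{j=1}^\infty(1+\beta_jz)$ with $C\in\mathbb C$, $m\in\mathbb N_0$, $\alpha\ge0$, $\beta_j\ge\beta_{j+1}\ge0$, $\sum_j\beta_j<\infty$ (Laguerre entire functions). $\mathcal L^+_a=\mathcal L^+\cap\mathcal A_a$, with the topology induced from $\mathcal A_a$. When $\omega=0$, $\omega^{-1}(e^{a\omega}-1)$ means $a$. *)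

theory Defs
  imports "HOL-Analysis.Analysis"
begin

definition kderiv :: "nat \<Rightarrow> (complex \<Rightarrow> complex) \<Rightarrow> complex \<Rightarrow> complex" where
  "kderiv k f = (deriv ^^ k) f"

definition normb :: "real \<Rightarrow> (complex \<Rightarrow> complex) \<Rightarrow> real" where
  "normb b f = (SUP k. norm (kderiv k f 0) / b ^ k)"

definition Aspace :: "real \<Rightarrow> (complex \<Rightarrow> complex) set" where
  "Aspace a = {f. f holomorphic_on UNIV \<and>
      (\<forall>b>a. bdd_above (range (\<lambda>k. norm (kderiv k f 0) / b ^ k)))}"

definition Atop :: "real \<Rightarrow> (complex \<Rightarrow> complex) topology" where
  "Atop a = topology (\<lambda>U. U \<subseteq> Aspace a \<and>
      (\<forall>f\<in>U. \<exists>B e. finite B \<and> B \<subseteq> {a<..} \<and> e > 0 \<and>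
          {g \<in> Aspace a. \<forall>b\<in>B. normb b (\<lambda>z. g z - f z) < e} \<subseteq> U))"

definition Laguerre :: "(complex \<Rightarrow> complex) set" where
  "Laguerre = {f. f holomorphic_on UNIV \<and>
      (\<exists>(C::complex) (m::nat) (\<alpha>::real) (\<beta>::nat \<Rightarrow> real).
         \<alpha> \<ge> 0 \<and> (\<forall>j. \<beta> j \<ge> \<beta> (Suc j)) \<and> (\<forall>j. \<beta> j \<ge> 0) \<and> summable \<beta> \<and>
         (\<forall>z. f z = C * z ^ m * exp (of_real \<alpha> * z) * (\<Prod>j. 1 + of_real (\<beta> j) * z)))}"

definition LaguerreA :: "real \<Rightarrow> (complex \<Rightarrow> complex) set" where
  "LaguerreA a = Laguerre \<inter> Aspace a"

definition LaguerreA_top :: "real \<Rightarrow> (complex \<Rightarrow> complex) topology" where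
  "LaguerreA_top a = subtopology (Atop a) (LaguerreA a)"

definition Delta :: "real \<Rightarrow> real \<Rightarrow> (complex \<Rightarrow> complex) \<Rightarrow> complex \<Rightarrow> complex" where
  "Delta \<theta> \<omega> g = (\<lambda>z. (of_real \<theta> + of_real \<omega> * z) * deriv g z + z * deriv (deriv g) z)"

definition phiDelta_term :: "real \<Rightarrow> real \<Rightarrow> (complex \<Rightarrow> complex) \<Rightarrow> (complex \<Rightarrow> complex) \<Rightarrow> complex \<Rightarrow> nat \<Rightarrow> complex" where
  "phiDelta_term \<theta> \<omega> \<phi> f z k = kderiv k \<phi> 0 / fact k * (Delta \<theta> \<omega> ^^ k) f z"

definition phiDelta :: "real \<Rightarrow> real \<Rightarrow> (complex \<Rightarrow> complex) \<Rightarrow> (complex \<Rightarrow> complex) \<Rightarrow> complex \<Rightarrow> complex" where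
  "phiDelta \<theta> \<omega> \<phi> f = (\<lambda>z. \<Sum>k. phiDelta_term \<theta> \<omega> \<phi> f z k)"

definition Eexp :: "real \<Rightarrow> real \<Rightarrow> real" where
  "Eexp \<omega> a = (if \<omega> = 0 then a else (exp (a * \<omega>) - 1) / \<omega>)"

end

theory Submission
  imports Defs "HOL-Complex_Analysis.Complex_Analysis"
    "HOL-Computational_Algebra.Fundamental_Theorem_Algebra"
begin

text \<open>On the sequence \<open>g\<close> of derivatives of \<open>f\<close> at \<open>0\<close> the operator \<open>\<Delta>\<close> acts as
  \<open>(T g) l = \<omega> l g l + (\<theta> + l) g (l + 1)\<close>, which has nonnegative entries. Its flow maps \<open>b\<^sup>l\<close> to
  \<open>A B\<^sup>l\<close> with \<open>B = b e\<^sup>t\<^sup>\<omega> / (1 - b (e\<^sup>t\<^sup>\<omega> - 1) / \<omega>)\<close>, so Taylor's formula with nonnegative remainder bounds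
  \<open>\<Sum>\<^sub>k a\<^sup>k (T\<^sup>k b) l / k!\<close> by \<open>A c\<^sup>l\<close>. By domination this yields convergence of the series, the type \<open>c\<close>, and a
  bilinear estimate, hence continuity.

  For the Laguerre property, approximate \<open>\<phi>\<close> and \<open>f\<close> by polynomials with nonpositive zeros and dominated
  coefficients. If \<open>f\<close> has only nonpositive zeros, so has \<open>\<kappa> f + \<Delta> f\<close>, unless it vanishes, for \<open>\<kappa> \<ge> 0\<close>: at any other
  point \<open>z\<close>, its quotient by \<open>f'\<close> lies in the pointed cone \<open>{x + y z | x, y \<ge> 0}\<close>. Factoring \<open>\<phi>\<close> transfers this
  to \<open>\<phi>(\<Delta>) f\<close>. A limit of such polynomials is a Laguerre function: normalised at \<open>1\<close>, the factors are
  \<open>1 + g (z - 1)\<close> with \<open>g\<close> in \<open>[0, 1]\<close>, and a diagonal subsequence of the sorted \<open>g\<close>'s converges.\<close>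

section \<open>Exponential generating functions of derivative sequences\<close>

text \<open>The seminorms of \<open>Aspace a\<close> are only guaranteed finite strictly beyond
  \<open>a\<close>, whereas \<open>c\<close> is computed from \<open>a\<close> and \<open>b\<close>
  themselves. So every estimate is made at slightly larger parameters \<open>a' > a\<close>,
  \<open>b' > b\<close>; the flow rate is continuous, hence they can be chosen with rate below any
  prescribed \<open>r > c\<close>. Enlarging also makes the time of the flow positive, as Taylor's
  formula requires. The limit of polynomials is examined at 1 because 1 is never a zero of a nonzero
  approximant, while 0 may be one. The coefficients are nonnegative up to a common factor, so the
  value at 1 dominates each of them and a nonzero limit cannot vanish there. A zero -r becomes g = 1
  / (1 + r), and the sum of the g's is the logarithmic derivative at 1, whose convergence bounds
  these sums uniformly. The coordinatewise limit may lose part of the sum; the lost mass is the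
  exponent \<alpha>. Logarithms give the product only near 1, and the identity theorem extends it to
  the plane.\<close>

lemma tannery_sequentially:
  fixes a :: "nat \<Rightarrow> nat \<Rightarrow> 'a :: {real_normed_algebra, banach}"
  assumes "\<And>k. (\<lambda>n. a k n) \<longlonglongrightarrow> b k" and "\<And>k n. norm (a k n) \<le> M k" and "summable M"
  shows "summable (\<lambda>k. norm (b k))" and "(\<lambda>n. \<Sum>k. a k n) \<longlonglongrightarrow> (\<Sum>k. b k)"
proof -
  have "eventually (\<lambda>(k,n). norm (a k n) \<le> M k) (at_top \<times>\<^sub>F sequentially)"
    using assms(2) by (auto intro: always_eventually)
  from tannerys_theorem[OF assms(1) this assms(3)]
  show "summable (\<lambda>k. norm (b k))" and "(\<lambda>n. \<Sum>k. a k n) \<longlonglongrightarrow> (\<Sum>k. b k)"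
    by auto
qed

text \<open>A finite sum over k commutes with the sum over l; Tannery's theorem with majorant
  \<open>H\<close> then lets the number of terms in k tend to infinity. The hypothesis bounds
  partial sums of \<open>G\<close> over k because the Taylor estimate arrives in that form.\<close>

lemma double_series_swap:
  fixes F :: "nat \<Rightarrow> nat \<Rightarrow> complex"
  assumes F: "\<And>k l. norm (F k l) \<le> G k l" and G: "\<And>N l. (\<Sum>k<N. G k l) \<le> H l" and H: "summable H"
  shows "(\<lambda>k. \<Sum>l. F k l) sums (\<Sum>l. \<Sum>k. F k l)"
proof -
  have G0: "0 \<le> G k l" for k l
    using norm_ge_zero F order_trans by blast
  have GH: "G k l \<le> H l" for k l
    using member_le_sum[of k "{..<Suc k}" "\<lambda>k. G k l"] G0 G[where N="Suc k" and l=l] by simp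
  have sumk: "summable (\<lambda>k. F k l)" for l
  proof (rule summable_comparison_test)
    show "summable (\<lambda>k. G k l)"
      by (rule bounded_imp_summable[where B="H l"])
         (use G0 G[where l=l] in \<open>auto simp del: sum.lessThan_Suc simp flip: lessThan_Suc_atMost\<close>)
  qed (use F in auto)
  have suml: "summable (\<lambda>l. F k l)" for k
    by (rule summable_comparison_test[OF _ H]) (use F GH order_trans in blast)
  have "(\<lambda>N. \<Sum>l. \<Sum>k<N. F k l) \<longlonglongrightarrow> (\<Sum>l. \<Sum>k. F k l)"
  proof (rule tannery_sequentially(2)[OF _ _ H])
    show "(\<lambda>N. \<Sum>k<N. F k l) \<longlonglongrightarrow> (\<Sum>k. F k l)" for l
      using sumk by (rule summable_LIMSEQ)
    show "norm (\<Sum>k<N. F k l) \<le> H l" for l N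
      by (rule order_trans[OF norm_sum order_trans[OF sum_mono G]]) (rule F)
  qed
  also have "(\<lambda>N. \<Sum>l. \<Sum>k<N. F k l) = (\<lambda>N. \<Sum>k<N. \<Sum>l. F k l)"
    by (intro ext suminf_sum suml)
  finally show ?thesis
    by (simp add: sums_def)
qed

text \<open>These are the derivative sequences at 0 of entire functions of exponential type, a class
  that contains those of every \<open>Aspace a\<close>; on it \<open>egf\<close> inverts the passage
  to derivatives.\<close>

definition geom_bounded :: "(nat \<Rightarrow> complex) \<Rightarrow> bool" where
  "geom_bounded g \<longleftrightarrow> (\<exists>M\<ge>0. \<exists>r\<ge>0. \<forall>l. norm (g l) \<le> M * r ^ l)"

definition egf :: "(nat \<Rightarrow> complex) \<Rightarrow> complex \<Rightarrow> complex" where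
  "egf g z = (\<Sum>l. g l / fact l * z ^ l)"

lemma summable_geom_exp: "summable (\<lambda>l. M * r ^ l * x ^ l / fact l)" for r :: real
  using summable_mult[OF summable_exp[of "r * x"], of M]
  by (simp add: power_mult_distrib field_simps)

lemma egf_summable_norm:
  assumes "geom_bounded g"
  shows "summable (\<lambda>l. norm (g l / fact l * z ^ l))"
proof -
  obtain M r where "0 \<le> M" "0 \<le> r" and b: "\<And>l. norm (g l) \<le> M * r ^ l"
    using assms by (auto simp: geom_bounded_def)
  show ?thesis
  proof (rule summable_comparison_test[OF _ summable_geom_exp], intro exI allI impI)
    fix l
    show "norm (norm (g l / fact l * z ^ l)) \<le> M * r ^ l * norm z ^ l / fact l"
      using b[of l] by (simp add: norm_mult norm_divide norm_power mult_right_mono divide_right_mono)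
  qed
qed

lemma egf_summable:
  assumes "geom_bounded g"
  shows "summable (\<lambda>l. g l / fact l * z ^ l)"
  using egf_summable_norm[OF assms] by (rule summable_norm_cancel)

lemma egf_sums: "geom_bounded g \<Longrightarrow> (\<lambda>l. g l / fact l * z ^ l) sums egf g z"
  unfolding egf_def by (rule summable_sums[OF egf_summable])

lemma geom_bounded_shift:
  assumes "geom_bounded g" shows "geom_bounded (\<lambda>l. g (Suc l))"
proof -
  obtain M r where "0 \<le> M" "0 \<le> r" "\<And>l. norm (g l) \<le> M * r ^ l"
    using assms by (auto simp: geom_bounded_def)
  then show ?thesis
    unfolding geom_bounded_def
    by (intro exI[of _ "M * r"] conjI exI[of _ r]) (auto simp: mult.assoc simp flip: power_Suc)
qed

lemma egf_has_field_derivative: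
  assumes "geom_bounded g"
  shows "(egf g has_field_derivative egf (\<lambda>l. g (Suc l)) z) (at z)"
proof -
  have "diffs (\<lambda>l. g l / fact l) = (\<lambda>l. g (Suc l) / fact l)"
    by (auto simp: diffs_def fact_Suc simp del: of_nat_Suc)
  then show ?thesis
    using termdiffs_strong_converges_everywhere[of "\<lambda>l. g l / fact l" z] egf_summable[OF assms]
    by (simp add: egf_def[abs_def])
qed

lemma deriv_egf: "geom_bounded g \<Longrightarrow> deriv (egf g) = egf (\<lambda>l. g (Suc l))"
  by (intro ext DERIV_imp_deriv egf_has_field_derivative)

lemma holomorphic_egf: "geom_bounded g \<Longrightarrow> egf g holomorphic_on UNIV"
  using egf_has_field_derivative by (auto simp: holomorphic_on_open)

lemma kderiv_egf: "geom_bounded g \<Longrightarrow> kderiv k (egf g) = egf (\<lambda>l. g (l + k))"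
proof (induction k)
  case 0
  then show ?case by (simp add: kderiv_def)
next
  case (Suc k)
  have "geom_bounded (\<lambda>l. g (l + k))"
    using Suc.prems by (induction k) (auto dest: geom_bounded_shift)
  with Suc show ?case by (simp add: kderiv_def deriv_egf)
qed

lemma egf_0: "egf g 0 = g 0"
  unfolding egf_def by (subst suminf_finite[of "{0}"]) auto

lemma kderiv_egf_0: "geom_bounded g \<Longrightarrow> kderiv k (egf g) 0 = g k"
  by (simp add: kderiv_egf egf_0)

lemma egf_mult_z:
  assumes "geom_bounded g" 
  shows "z * egf g z = egf (\<lambda>l. of_nat l * g (l - 1)) z"
proof -
  have "(\<lambda>l. z * (g l / fact l * z ^ l)) sums (z * egf g z)"
    by (rule sums_mult[OF egf_sums[OF assms]])
  also have "(\<lambda>l. z * (g l / fact l * z ^ l))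
      = (\<lambda>l. of_nat (Suc l) * g (Suc l - 1) / fact (Suc l) * z ^ Suc l)"
    by (auto simp: fact_Suc simp del: of_nat_Suc)
  finally have "(\<lambda>l. of_nat l * g (l - 1) / fact l * z ^ l) sums (z * egf g z)"
    using sums_Suc[of "\<lambda>l. of_nat l * g (l - 1) / fact l * z ^ l"] by (simp only: of_nat_0) simp
  then show ?thesis
    by (simp add: egf_def sums_iff)
qed

lemma egf_add:
  "geom_bounded g \<Longrightarrow> geom_bounded h \<Longrightarrow> egf g z + egf h z = egf (\<lambda>l. g l + h l) z"
  using sums_add[OF egf_sums egf_sums, of g h z z]
  by (simp add: egf_def sums_iff add_divide_distrib ring_distribs)

lemma egf_cmult: "geom_bounded g \<Longrightarrow> c * egf g z = egf (\<lambda>l. c * g l) z"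
  using sums_mult[OF egf_sums, of g c z]
  by (simp add: egf_def sums_iff mult.assoc flip: times_divide_eq_right)

section \<open>The action of \<open>\<Delta>\<close> on derivative sequences\<close>

text \<open>The value type is polymorphic so that the same operator acts on complex derivative
  sequences and on their real majorants.\<close>

definition opT :: "real \<Rightarrow> real \<Rightarrow> (nat \<Rightarrow> 'a) \<Rightarrow> nat \<Rightarrow> 'a :: real_normed_vector" where
  "opT \<theta> \<omega> g l = (\<omega> * real l) *\<^sub>R g l + (\<theta> + real l) *\<^sub>R g (Suc l)"

text \<open>The weights l cost a factor 2^l, so the rate doubles in this bound. That suffices to
  keep the iterates in the domain of \<open>egf\<close>; bounds uniform in the number of iterations
  come from the flow.\<close>

lemma geom_bounded_opT:
  assumes "geom_bounded g" shows "geom_bounded (opT \<theta> \<omega> g)"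
proof -
  obtain M r where M: "0 \<le> M" and r: "0 \<le> r" and b: "\<And>l. norm (g l) \<le> M * r ^ l"
    using assms by (auto simp: geom_bounded_def)
  let ?K = "\<bar>\<omega>\<bar> + (\<bar>\<theta>\<bar> + 1) * r"
  have "norm (opT \<theta> \<omega> g l) \<le> (?K * M) * (2 * r) ^ l" for l
  proof -
    have l2: "real l \<le> 2 ^ l" "(1::real) \<le> 2 ^ l"
      using less_exp[of l] by (simp_all add: less_imp_le)
    have "norm (opT \<theta> \<omega> g l) \<le> \<bar>\<omega> * real l\<bar> * norm (g l) + \<bar>\<theta> + real l\<bar> * norm (g (Suc l))"
      unfolding opT_def by (rule order_trans[OF norm_triangle_ineq]) simp
    also have "\<dots> \<le> (\<bar>\<omega>\<bar> * 2 ^ l) * (M * r ^ l) + ((\<bar>\<theta>\<bar> + 1) * 2 ^ l) * (M * r ^ Suc l)"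
    proof (intro add_mono mult_mono b)
      show "\<bar>\<omega> * real l\<bar> \<le> \<bar>\<omega>\<bar> * 2 ^ l"
        using l2 by (simp add: abs_mult mult_left_mono)
      have "\<bar>\<theta> + real l\<bar> \<le> \<bar>\<theta>\<bar> * 1 + real l" by simp
      also have "\<dots> \<le> \<bar>\<theta>\<bar> * 2 ^ l + 2 ^ l" by (intro add_mono mult_left_mono l2) auto
      finally show "\<bar>\<theta> + real l\<bar> \<le> (\<bar>\<theta>\<bar> + 1) * 2 ^ l" by (simp add: algebra_simps)
    qed auto
    also have "\<dots> = (?K * M) * (2 * r) ^ l"
      by (simp add: algebra_simps power_mult_distrib)
    finally show ?thesis .
  qed
  moreover have "?K * M \<ge> 0" using M r by simp
  ultimately show ?thesis
    unfolding geom_bounded_def using r by (intro exI[of _ "?K * M"] conjI exI[of _ "2 * r"]) auto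
qed

lemma geom_bounded_of_nat_mult:
  assumes "geom_bounded g" shows "geom_bounded (\<lambda>l. of_nat l * g l)"
proof -
  obtain M r where M: "0 \<le> M" and r: "0 \<le> r" and b: "\<And>l. norm (g l) \<le> M * r ^ l"
    using assms by (auto simp: geom_bounded_def)
  have "norm (of_nat l * g l) \<le> M * (2 * r) ^ l" for l
  proof -
    have "real l \<le> 2 ^ l" using less_exp[of l] by (simp add: less_imp_le)
    then have "norm (of_nat l * g l) \<le> 2 ^ l * (M * r ^ l)"
      unfolding norm_mult using b[of l] by (intro mult_mono) auto
    then show ?thesis by (simp add: power_mult_distrib mult_ac)
  qed
  then show ?thesis
    unfolding geom_bounded_def using M r by (intro exI[of _ M] conjI exI[of _ "2 * r"]) auto
qed

lemma geom_bounded_add_cmult: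
  assumes "geom_bounded g" "geom_bounded h" shows "geom_bounded (\<lambda>l. c * g l + d * h l)"
proof -
  obtain M r where M: "0 \<le> M" and r: "0 \<le> r" and b: "\<And>l. norm (g l) \<le> M * r ^ l"
    using assms(1) by (auto simp: geom_bounded_def)
  obtain N s where N: "0 \<le> N" and s: "0 \<le> s" and e: "\<And>l. norm (h l) \<le> N * s ^ l"
    using assms(2) by (auto simp: geom_bounded_def)
  have "norm (c * g l + d * h l) \<le> (norm c * M + norm d * N) * (max r s) ^ l" for l
  proof -
    have "norm (c * g l + d * h l) \<le> norm c * norm (g l) + norm d * norm (h l)"
      by (rule order_trans[OF norm_triangle_ineq]) (simp add: norm_mult)
    also have "\<dots> \<le> norm c * (M * max r s ^ l) + norm d * (N * max r s ^ l)"
      using r s M N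
      by (intro add_mono mult_left_mono order_trans[OF b] order_trans[OF e] power_mono) auto
    finally show ?thesis by (simp add: algebra_simps)
  qed
  then show ?thesis
    unfolding geom_bounded_def using M N r
    by (intro exI[of _ "norm c * M + norm d * N"] conjI exI[of _ "max r s"]) auto
qed

lemma Delta_egf:
  assumes "geom_bounded g"
  shows "Delta \<theta> \<omega> (egf g) = egf (opT \<theta> \<omega> g)"
proof
  fix z
  let ?S = "\<lambda>l. g (Suc l)" and ?SS = "\<lambda>l. g (Suc (Suc l))"
  have S: "geom_bounded ?S" and SS: "geom_bounded ?SS"
    using geom_bounded_shift geom_bounded_shift[OF geom_bounded_shift] assms by blast+
  have z1: "z * egf ?S z = egf (\<lambda>l. of_nat l * g l) z"
  proof -
    have "(\<lambda>l. of_nat l * g (Suc (l - 1))) = (\<lambda>l. of_nat l * g l)"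
      by (rule ext) (case_tac l, auto)
    then show ?thesis using egf_mult_z[OF S] by simp
  qed
  have z2: "z * egf ?SS z = egf (\<lambda>l. of_nat l * g (Suc l)) z"
  proof -
    have "(\<lambda>l. of_nat l * g (Suc (Suc (l - 1)))) = (\<lambda>l. of_nat l * g (Suc l))"
      by (rule ext) (case_tac l, auto)
    then show ?thesis using egf_mult_z[OF SS] by simp
  qed
  have b1: "geom_bounded (\<lambda>l. of_nat l * g l)" and b2: "geom_bounded (\<lambda>l. of_nat l * g (Suc l))"
    using geom_bounded_of_nat_mult assms S by blast+
  have b3: "geom_bounded (\<lambda>l. of_real \<theta> * g (Suc l) + of_real \<omega> * (of_nat l * g l))"
    by (rule geom_bounded_add_cmult[OF S b1])
  have b4: "geom_bounded (\<lambda>l. of_real \<theta> * g (Suc l))" "geom_bounded (\<lambda>l. of_real \<omega> * (of_nat l * g l))"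
    using geom_bounded_add_cmult[OF S S, of "of_real \<theta>" 0]
      geom_bounded_add_cmult[OF b1 b1, of "of_real \<omega>" 0] by simp_all
  have "Delta \<theta> \<omega> (egf g) z
      = of_real \<theta> * egf ?S z + of_real \<omega> * (z * egf ?S z) + z * egf ?SS z"
    by (simp add: Delta_def deriv_egf assms S algebra_simps)
  also have "\<dots> = egf (\<lambda>l. of_real \<theta> * g (Suc l) + of_real \<omega> * (of_nat l * g l) + of_nat l * g (Suc l)) z"
    unfolding z1 z2 by (simp add: egf_cmult egf_add S b1 b2 b3 b4)
  also have "(\<lambda>l. of_real \<theta> * g (Suc l) + of_real \<omega> * (of_nat l * g l) + of_nat l * g (Suc l)) = opT \<theta> \<omega> g"
    by (auto simp: opT_def scaleR_conv_of_real algebra_simps)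
  finally show "Delta \<theta> \<omega> (egf g) z = egf (opT \<theta> \<omega> g) z" .
qed

lemma geom_bounded_opT_funpow: "geom_bounded g \<Longrightarrow> geom_bounded ((opT \<theta> \<omega> ^^ k) g)"
  by (induction k) (auto intro: geom_bounded_opT)

lemma Delta_funpow_egf:
  "geom_bounded g \<Longrightarrow> (Delta \<theta> \<omega> ^^ k) (egf g) = egf ((opT \<theta> \<omega> ^^ k) g)"
  by (induction k) (auto simp: Delta_egf geom_bounded_opT_funpow)

lemma opT_funpow_Suc:
  "(opT \<theta> \<omega> ^^ Suc k) g l =
     (\<omega> * real l) *\<^sub>R (opT \<theta> \<omega> ^^ k) g l + (\<theta> + real l) *\<^sub>R (opT \<theta> \<omega> ^^ k) g (Suc l)"
  by (simp only: funpow.simps o_apply opT_def[of \<theta> \<omega> "(opT \<theta> \<omega> ^^ k) g" l])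

lemma norm_opT_funpow_le:
  fixes G :: "nat \<Rightarrow> real"
  assumes "\<theta> \<ge> 0" "\<omega> \<ge> 0" "\<And>l. norm (g l) \<le> G l"
  shows "norm ((opT \<theta> \<omega> ^^ k) g l) \<le> (opT \<theta> \<omega> ^^ k) G l"
proof (induction k arbitrary: l)
  case (Suc k)
  have "norm ((opT \<theta> \<omega> ^^ Suc k) g l)
     \<le> (\<omega> * real l) * norm ((opT \<theta> \<omega> ^^ k) g l) + (\<theta> + real l) * norm ((opT \<theta> \<omega> ^^ k) g (Suc l))"
    unfolding opT_funpow_Suc using assms by (intro order_trans[OF norm_triangle_ineq]) simp
  also have "\<dots> \<le> (opT \<theta> \<omega> ^^ Suc k) G l"
    unfolding opT_funpow_Suc real_scaleR_def
    using assms(1,2) by (intro add_mono mult_left_mono Suc.IH) auto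
  finally show ?case .
qed (use assms in auto)

lemma opT_funpow_lincomb:
  "(opT \<theta> \<omega> ^^ k) (\<lambda>l. x * g l + y * h l) l
     = x * (opT \<theta> \<omega> ^^ k) g l + y * (opT \<theta> \<omega> ^^ k) h l" for g :: "nat \<Rightarrow> 'a :: real_normed_algebra"
  by (induction k arbitrary: l) (simp_all add: opT_funpow_Suc algebra_simps del: funpow.simps(2))

lemma opT_funpow_cmult:
  "(opT \<theta> \<omega> ^^ k) (\<lambda>l. x * g l) l = x * (opT \<theta> \<omega> ^^ k) g l" for g :: "nat \<Rightarrow> 'a :: real_normed_algebra"
  by (induction k arbitrary: l) (simp_all add: opT_funpow_Suc algebra_simps del: funpow.simps(2))

section \<open>The flow generated by \<open>\<Delta>\<close> on geometric sequences\<close>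

lemma Eexp_has_derivative: "(Eexp \<omega> has_real_derivative exp (t * \<omega>)) (at t)"
proof (cases "\<omega> = 0")
  case True
  then show ?thesis by (simp add: Eexp_def[abs_def])
next
  case False
  have "((\<lambda>a. (exp (a * \<omega>) - 1) / \<omega>) has_real_derivative exp (t * \<omega>)) (at t)"
    by (auto intro!: derivative_eq_intros simp: False)
  with False show ?thesis by (simp add: Eexp_def[abs_def])
qed

lemma Eexp_0 [simp]: "Eexp \<omega> 0 = 0"
  by (simp add: Eexp_def)

lemma Eexp_mono: "s \<le> t \<Longrightarrow> Eexp \<omega> s \<le> Eexp \<omega> t"
  by (rule DERIV_nonneg_imp_nondecreasing[where f="Eexp \<omega>"]) (use Eexp_has_derivative exp_ge_zero in blast)+

text \<open>At time \<open>a\<close> this is the \<open>c\<close> of the theorem. For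
  \<open>b > 0\<close> it blows up as \<open>b * Eexp \<omega> t\<close> increases to 1, which
  explains the smallness hypothesis.\<close>

definition flow_rate :: "real \<Rightarrow> real \<Rightarrow> real \<Rightarrow> real" where
  "flow_rate \<omega> b t = b * exp (t * \<omega>) / (1 - b * Eexp \<omega> t)"

definition flow_factor :: "real \<Rightarrow> real \<Rightarrow> real \<Rightarrow> real \<Rightarrow> real" where
  "flow_factor \<theta> \<omega> b t = (1 - b * Eexp \<omega> t) powr (- \<theta>)"

text \<open>The rate \<open>B\<close> and the factor \<open>A\<close> solve \<open>B' = \<omega> B + B\<^sup>2\<close> and \<open>A' = \<theta> A B\<close>, so that
  \<open>t \<mapsto> A B\<^sup>l\<close> is the orbit of \<open>b\<^sup>l\<close> under the semigroup generated by \<^const>\<open>opT\<close>.\<close>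

definition flow :: "real \<Rightarrow> real \<Rightarrow> real \<Rightarrow> real \<Rightarrow> nat \<Rightarrow> real" where
  "flow \<theta> \<omega> b t l = flow_factor \<theta> \<omega> b t * flow_rate \<omega> b t ^ l"

lemma flow_0: "flow \<theta> \<omega> b 0 = (\<lambda>l. b ^ l)"
  by (simp add: flow_def flow_factor_def flow_rate_def fun_eq_iff)

lemma flow_has_derivative:
  assumes "b * Eexp \<omega> t < 1"
  shows "((\<lambda>t. flow \<theta> \<omega> b t l) has_real_derivative opT \<theta> \<omega> (flow \<theta> \<omega> b t) l) (at t)"
proof -
  let ?D = "1 - b * Eexp \<omega> t"
  have D: "?D > 0" using assms by simp
  note E = Eexp_has_derivative[of \<omega> t]
  have B: "(flow_rate \<omega> b has_real_derivative \<omega> * flow_rate \<omega> b t + flow_rate \<omega> b t ^ 2) (at t)"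
  proof -
    have "((\<lambda>t. b * exp (t * \<omega>)) has_real_derivative b * exp (t * \<omega>) * \<omega>) (at t)"
      by (auto intro!: derivative_eq_intros)
    moreover have "((\<lambda>t. 1 - b * Eexp \<omega> t) has_real_derivative - (b * exp (t * \<omega>))) (at t)"
      using DERIV_diff[OF DERIV_const DERIV_cmult[OF E]] by simp
    ultimately have "((\<lambda>t. b * exp (t * \<omega>) / (1 - b * Eexp \<omega> t)) has_real_derivative
        (b * exp (t * \<omega>) * \<omega> * ?D - b * exp (t * \<omega>) * - (b * exp (t * \<omega>))) / (?D * ?D)) (at t)"
      using D by (intro DERIV_divide) auto
    moreover have "(u * \<omega> * d - u * - u) / (d * d) = \<omega> * (u / d) + (u / d)\<^sup>2" if "d \<noteq> 0" for u d :: real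
      using that by (simp add: field_simps power2_eq_square)
    ultimately show ?thesis
      unfolding flow_rate_def using D by simp
  qed
  have A: "(flow_factor \<theta> \<omega> b has_real_derivative \<theta> * flow_factor \<theta> \<omega> b t * flow_rate \<omega> b t) (at t)"
  proof -
    have "((\<lambda>t. (1 - b * Eexp \<omega> t) powr (- \<theta>)) has_real_derivative
        - \<theta> * ?D powr (- \<theta> - 1) * (- (b * exp (t * \<omega>)))) (at t)"
      by (rule DERIV_fun_powr[THEN DERIV_cong])
         (use D in \<open>auto intro!: derivative_eq_intros E\<close>)
    moreover have "?D powr (- \<theta> - 1) = ?D powr (- \<theta>) / ?D"
      using D by (simp add: powr_diff)
    ultimately show ?thesis
      by (simp add: flow_factor_def[abs_def] flow_rate_def field_simps)
  qed
  have "((\<lambda>t. flow \<theta> \<omega> b t l) has_real_derivative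
     flow_factor \<theta> \<omega> b t * (real l * ((\<omega> * flow_rate \<omega> b t + flow_rate \<omega> b t ^ 2) * flow_rate \<omega> b t ^ (l - 1)))
     + \<theta> * flow_factor \<theta> \<omega> b t * flow_rate \<omega> b t * flow_rate \<omega> b t ^ l) (at t)"
    unfolding flow_def using A B by (auto intro!: derivative_eq_intros)
  \<comment> \<open>With A the factor and B the rate, l B' B^(l-1) = l (\<omega> B^l + B^(l+1)) and
    A' B^l = \<theta> A B^(l+1). The case l = 0 is separate because of the truncated exponent l -
    1.\<close>
  also have "flow_factor \<theta> \<omega> b t * (real l * ((\<omega> * flow_rate \<omega> b t + flow_rate \<omega> b t ^ 2) * flow_rate \<omega> b t ^ (l - 1)))
     + \<theta> * flow_factor \<theta> \<omega> b t * flow_rate \<omega> b t * flow_rate \<omega> b t ^ l = opT \<theta> \<omega> (flow \<theta> \<omega> b t) l"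
    by (cases l) (simp_all add: opT_def flow_def algebra_simps power2_eq_square)
  finally show ?thesis .
qed

text \<open>Each entry of an iterate is a finite combination of entries of \<open>v t\<close> with
  constant weights, so differentiation passes through it.\<close>

lemma opT_funpow_has_derivative:
  assumes "\<And>l. ((\<lambda>t. v t l) has_real_derivative v' l) (at t)"
  shows "((\<lambda>t. (opT \<theta> \<omega> ^^ k) (v t) l) has_real_derivative (opT \<theta> \<omega> ^^ k) v' l) (at t)"
proof (induction k arbitrary: l)
  case (Suc k)
  show ?case
    unfolding opT_funpow_Suc real_scaleR_def by (intro DERIV_add DERIV_cmult Suc.IH)
qed (use assms in auto)

lemma flow_Taylor_bound:
  assumes "\<theta> \<ge> 0" "\<omega> \<ge> 0" "a > 0" "b \<ge> 0" "b * Eexp \<omega> a < 1"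
  shows "(\<Sum>k<N. a ^ k / fact k * (opT \<theta> \<omega> ^^ k) (\<lambda>l. b ^ l) l) \<le> flow \<theta> \<omega> b a l"
proof (cases "N = 0")
  case True
  with assms show ?thesis by (simp add: flow_def flow_factor_def flow_rate_def)
next
  case False
  have lt1: "b * Eexp \<omega> t < 1" if "t \<le> a" for t
    using Eexp_mono[OF that, of \<omega>] assms(4,5) by (meson le_less_trans mult_left_mono)
  \<comment> \<open>One time derivative of the flow is one application of \<open>opT\<close>, so
    \<open>diff k\<close> is the k-th derivative of the l-th entry.\<close>
  define diff where "diff = (\<lambda>k t. (opT \<theta> \<omega> ^^ k) (flow \<theta> \<omega> b t) l)"
  have "\<forall>m t. m < N \<and> 0 \<le> t \<and> t \<le> a \<longrightarrow> DERIV (diff m) t :> diff (Suc m) t"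
  proof (intro allI impI)
    fix m t assume "m < N \<and> 0 \<le> t \<and> t \<le> a"
    then show "DERIV (diff m) t :> diff (Suc m) t"
      unfolding diff_def funpow_Suc_right o_apply
      by (intro opT_funpow_has_derivative flow_has_derivative lt1) auto
  qed
  from Maclaurin[OF assms(3) _ refl this] False obtain t where t: "0 < t" "t < a"
    and eq: "diff 0 a = (\<Sum>m<N. diff m 0 / fact m * a ^ m) + diff N t / fact N * a ^ N"
    by auto
  \<comment> \<open>The Lagrange remainder is nonnegative because iterates of \<open>opT\<close> are
    monotone and the flow dominates the zero sequence.\<close>
  have "0 \<le> diff N t"
  proof -
    have "0 \<le> norm ((opT \<theta> \<omega> ^^ N) (\<lambda>_. 0 :: real) l)" by simp
    also have "\<dots> \<le> diff N t"
      unfolding diff_def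
      using lt1[of t] t assms by (intro norm_opT_funpow_le) (auto simp: flow_def flow_factor_def flow_rate_def)
    finally show ?thesis .
  qed
  with eq assms show ?thesis
    by (simp add: diff_def flow_0 mult_ac)
qed


lemma flow_rate_nonneg: "b \<ge> 0 \<Longrightarrow> b * Eexp \<omega> t < 1 \<Longrightarrow> 0 \<le> flow_rate \<omega> b t"
  by (simp add: flow_rate_def)

text \<open>Both requirements are strict inequalities that hold in the limit s -> 0+ for the
  parameters a + s and b + s, hence for some s > 0.\<close>

lemma flow_rate_approx:
  assumes "b * Eexp \<omega> a < 1" "c' > flow_rate \<omega> b a"
  obtains a' b' where "a' > a" "b' > b" "b' * Eexp \<omega> a' < 1" "flow_rate \<omega> b' a' \<le> c'"
proof -
  have E: "((\<lambda>s. Eexp \<omega> (a + s)) \<longlongrightarrow> Eexp \<omega> (a + 0)) (at_right 0)"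
  proof -
    have "isCont (Eexp \<omega>) (a + 0)"
      using Eexp_has_derivative DERIV_isCont by blast
    then show ?thesis
      by (rule isCont_tendsto_compose) (intro tendsto_intros)
  qed
  have 1: "((\<lambda>s. (b + s) * Eexp \<omega> (a + s)) \<longlongrightarrow> (b + 0) * Eexp \<omega> (a + 0)) (at_right 0)"
    by (intro tendsto_intros E)
  have 2: "((\<lambda>s. flow_rate \<omega> (b + s) (a + s)) \<longlongrightarrow> flow_rate \<omega> (b + 0) (a + 0)) (at_right 0)"
    unfolding flow_rate_def using assms by (intro tendsto_intros E) auto
  have "eventually (\<lambda>s. (b + s) * Eexp \<omega> (a + s) < 1) (at_right 0)"
    using order_tendstoD(2)[OF 1, of 1] assms by simp
  moreover have "eventually (\<lambda>s. flow_rate \<omega> (b + s) (a + s) < c') (at_right 0)"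
    using order_tendstoD(2)[OF 2, of c'] assms by simp
  moreover have "eventually (\<lambda>s::real. s > 0) (at_right 0)"
    by (rule eventually_at_right_less)
  ultimately have "eventually (\<lambda>s. (b + s) * Eexp \<omega> (a + s) < 1
      \<and> flow_rate \<omega> (b + s) (a + s) < c' \<and> s > 0) (at_right 0)"
    by (intro eventually_conj)
  then obtain s where "(b + s) * Eexp \<omega> (a + s) < 1" "flow_rate \<omega> (b + s) (a + s) < c'" "s > 0"
    using eventually_happens trivial_limit_at_right_real by blast
  then show thesis
    by (intro that[of "a + s" "b + s"]) auto
qed

section \<open>The operator series on derivative sequences\<close>

definition opcoef :: "real \<Rightarrow> real \<Rightarrow> (nat \<Rightarrow> complex) \<Rightarrow> (nat \<Rightarrow> complex) \<Rightarrow> nat \<Rightarrow> complex" where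
  "opcoef \<theta> \<omega> x g l = (\<Sum>k. x k / fact k * (opT \<theta> \<omega> ^^ k) g l)"

text \<open>\<open>M\<close> and \<open>N\<close> later become the norms of \<phi> and f at the
  enlarged parameters, and the resulting bounds contain the product \<open>M * N\<close>. This
  yields the bilinear estimate behind continuity.\<close>

locale op_bounds =
  fixes \<theta> \<omega> a b M N :: real and x g :: "nat \<Rightarrow> complex"
  assumes nonneg: "\<theta> \<ge> 0" "\<omega> \<ge> 0" "a > 0" "b \<ge> 0" and lt1: "b * Eexp \<omega> a < 1"
    and x_le: "\<And>k. norm (x k) \<le> M * a ^ k" and g_le: "\<And>l. norm (g l) \<le> N * b ^ l"
begin

text \<open>It depends on the real parameters alone and not on \<open>x\<close> and
  \<open>g\<close>, so one majorant serves a whole sequence of pairs when limits are taken.\<close>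

definition majorant :: "nat \<Rightarrow> nat \<Rightarrow> real" where
  "majorant k l = M * N * (a ^ k / fact k * (opT \<theta> \<omega> ^^ k) (\<lambda>l. b ^ l) l)"

lemma MN_nonneg: "0 \<le> M" "0 \<le> N"
proof -
  have "0 \<le> norm (x 0)" "0 \<le> norm (g 0)" by auto
  then show "0 \<le> M" "0 \<le> N" using order_trans[OF _ x_le[of 0]] order_trans[OF _ g_le[of 0]] by simp_all
qed

lemma norm_term_le: "norm (x k / fact k * (opT \<theta> \<omega> ^^ k) g l) \<le> majorant k l"
proof -
  have "norm (x k / fact k * (opT \<theta> \<omega> ^^ k) g l) = norm (x k) / fact k * norm ((opT \<theta> \<omega> ^^ k) g l)"
    by (simp add: norm_mult norm_divide)
  also have "\<dots> \<le> (M * a ^ k / fact k) * (opT \<theta> \<omega> ^^ k) (\<lambda>l. N * b ^ l) l"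
    using MN_nonneg nonneg
    by (intro mult_mono divide_right_mono x_le norm_opT_funpow_le g_le) auto
  also have "\<dots> = majorant k l"
    by (simp add: majorant_def opT_funpow_cmult)
  finally show ?thesis .
qed

lemma majorant_nonneg: "0 \<le> majorant k l"
  using norm_ge_zero norm_term_le order_trans by blast

lemma sum_majorant_le: "(\<Sum>k<n. majorant k l) \<le> M * N * flow \<theta> \<omega> b a l"
  unfolding majorant_def sum_distrib_left[symmetric]
  using MN_nonneg nonneg lt1 by (intro mult_left_mono flow_Taylor_bound) auto

lemma majorant_summable: "summable (\<lambda>k. majorant k l)"
  by (rule bounded_imp_summable[where B="M * N * flow \<theta> \<omega> b a l"])
     (use majorant_nonneg sum_majorant_le[where l=l] in
       \<open>auto simp del: sum.lessThan_Suc simp flip: lessThan_Suc_atMost\<close>)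

lemma opcoef_summable: "summable (\<lambda>k. x k / fact k * (opT \<theta> \<omega> ^^ k) g l)"
  by (rule summable_comparison_test[OF _ majorant_summable[of l]]) (use norm_term_le in auto)

lemma norm_opcoef_le:
  "norm (opcoef \<theta> \<omega> x g l) \<le> M * N * flow_factor \<theta> \<omega> b a * flow_rate \<omega> b a ^ l"
proof -
  have "norm (opcoef \<theta> \<omega> x g l) \<le> (\<Sum>k. majorant k l)"
    unfolding opcoef_def by (rule norm_suminf_le[OF norm_term_le majorant_summable])
  also have "\<dots> \<le> M * N * flow \<theta> \<omega> b a l"
    by (rule suminf_le_const[OF majorant_summable sum_majorant_le])
  finally show ?thesis by (simp add: flow_def mult_ac)
qed

lemma geom_bounded_x: "geom_bounded x" and geom_bounded_g: "geom_bounded g"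
  unfolding geom_bounded_def using MN_nonneg nonneg x_le g_le less_imp_le by blast+

text \<open>Each term is itself a power series in z. Summing over k first leaves the flow at index
  l, which grows geometrically in l and is therefore summable against |z|^l / l!; this justifies the
  interchange.\<close>

lemma phiDelta_term_sums:
  "phiDelta_term \<theta> \<omega> (egf x) (egf g) z sums egf (opcoef \<theta> \<omega> x g) z"
proof -
  let ?F = "\<lambda>k l. x k / fact k * (opT \<theta> \<omega> ^^ k) g l * (z ^ l / fact l)"
  have "(\<lambda>k. \<Sum>l. ?F k l) sums (\<Sum>l. \<Sum>k. ?F k l)"
  proof (rule double_series_swap)
    show "norm (?F k l) \<le> majorant k l * (norm z ^ l / fact l)" for k l
      unfolding norm_mult[of _ "z ^ l / fact l"] by (intro mult_mono norm_term_le majorant_nonneg) (auto simp: norm_divide norm_power)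
    show "(\<Sum>k<n. majorant k l * (norm z ^ l / fact l)) \<le> M * N * flow \<theta> \<omega> b a l * (norm z ^ l / fact l)" for n l
      unfolding sum_distrib_right[symmetric] by (intro mult_right_mono sum_majorant_le) auto
    show "summable (\<lambda>l. M * N * flow \<theta> \<omega> b a l * (norm z ^ l / fact l))"
      using summable_geom_exp[of "M * N * flow_factor \<theta> \<omega> b a" "flow_rate \<omega> b a" "norm z"]
      by (simp add: flow_def mult_ac)
  qed
  moreover have "(\<Sum>l. ?F k l) = phiDelta_term \<theta> \<omega> (egf x) (egf g) z k" for k
  proof -
    have "(\<lambda>l. x k / fact k * ((opT \<theta> \<omega> ^^ k) g l / fact l * z ^ l))
        sums (x k / fact k * egf ((opT \<theta> \<omega> ^^ k) g) z)"
      by (intro sums_mult egf_sums geom_bounded_opT_funpow geom_bounded_g)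
    then show ?thesis
      by (simp add: phiDelta_term_def kderiv_egf_0 geom_bounded_x Delta_funpow_egf geom_bounded_g
          sums_iff mult_ac)
  qed
  moreover have "(\<Sum>k. ?F k l) = opcoef \<theta> \<omega> x g l / fact l * z ^ l" for l
    unfolding opcoef_def using suminf_mult2[OF opcoef_summable, of l "z ^ l / fact l"] by simp
  ultimately show ?thesis
    by (simp add: egf_def)
qed

lemma phiDelta_egf: "phiDelta \<theta> \<omega> (egf x) (egf g) = egf (opcoef \<theta> \<omega> x g)"
  unfolding phiDelta_def using phiDelta_term_sums by (auto simp: sums_iff)

end

lemma opcoef_tendsto:
  assumes "\<And>n. op_bounds \<theta> \<omega> a b M N (x n) (g n)"
    and "\<And>k. (\<lambda>n. x n k) \<longlonglongrightarrow> x' k" and "\<And>l. (\<lambda>n. g n l) \<longlonglongrightarrow> g' l"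
  shows "(\<lambda>n. opcoef \<theta> \<omega> (x n) (g n) l) \<longlonglongrightarrow> opcoef \<theta> \<omega> x' g' l"
  unfolding opcoef_def
proof (rule tannery_sequentially(2))
  have T: "(\<lambda>n. (opT \<theta> \<omega> ^^ k) (g n) l) \<longlonglongrightarrow> (opT \<theta> \<omega> ^^ k) g' l" for k l
    by (induction k arbitrary: l)
       (auto simp: opT_funpow_Suc assms(3) simp del: funpow.simps(2) intro!: tendsto_intros)
  show "(\<lambda>n. x n k / fact k * (opT \<theta> \<omega> ^^ k) (g n) l) \<longlonglongrightarrow> x' k / fact k * (opT \<theta> \<omega> ^^ k) g' l" for k
    by (intro tendsto_intros assms(2) T) auto
  show "norm (x n k / fact k * (opT \<theta> \<omega> ^^ k) (g n) l) \<le> op_bounds.majorant \<theta> \<omega> a b M N k l" for k n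
    by (rule op_bounds.norm_term_le[OF assms(1)])
  show "summable (\<lambda>k. op_bounds.majorant \<theta> \<omega> a b M N k l)"
    by (rule op_bounds.majorant_summable[OF assms(1)])
qed

section \<open>The spaces \<open>\<A>\<^sub>a\<close>\<close>

lemma Aspace_normb_bound:
  assumes "f \<in> Aspace a" "r > a" "r > 0"
  shows "norm (kderiv k f 0) \<le> normb r f * r ^ k"
proof -
  have "norm (kderiv k f 0) / r ^ k \<le> normb r f"
    unfolding normb_def using assms by (intro cSUP_upper) (auto simp: Aspace_def)
  then show ?thesis using assms by (simp add: field_simps)
qed

lemma normb_le:
  assumes "\<And>k. norm (kderiv k f 0) \<le> M * r ^ k" "r > 0"
  shows "normb r f \<le> M"
  unfolding normb_def using assms by (intro cSUP_least) (auto simp: field_simps)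

lemma normb_nonneg: "f \<in> Aspace a \<Longrightarrow> r > a \<Longrightarrow> r > 0 \<Longrightarrow> 0 \<le> normb r f"
  using order_trans[OF norm_ge_zero Aspace_normb_bound[of f a r 0]] by simp

lemma Aspace_geom_bounded:
  assumes "f \<in> Aspace a" shows "geom_bounded (\<lambda>k. kderiv k f 0)"
proof -
  let ?r = "max a 0 + 1"
  have "?r > a" "?r > 0" by auto
  with assms show ?thesis
    unfolding geom_bounded_def
    by (intro exI[of _ "normb ?r f"] conjI exI[of _ ?r])
       (auto intro: normb_nonneg Aspace_normb_bound)
qed

lemma egf_kderiv:
  assumes "f holomorphic_on UNIV" shows "egf (\<lambda>k. kderiv k f 0) = f"
proof
  fix z
  have "(\<lambda>n. (deriv ^^ n) f 0 / fact n * (z - 0) ^ n) sums f z"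
    by (rule holomorphic_power_series[of f 0 "norm z + 1"])
       (use assms holomorphic_on_subset in auto)
  then show "egf (\<lambda>k. kderiv k f 0) z = f z"
    by (simp add: egf_def kderiv_def sums_iff)
qed

lemma egf_in_Aspace:
  assumes "a \<ge> 0" "\<And>r. r > a \<Longrightarrow> \<exists>M. \<forall>l. norm (g l) \<le> M * r ^ l"
  shows "egf g \<in> Aspace a"
proof -
  obtain M where M: "\<And>l. norm (g l) \<le> M * (a + 1) ^ l"
    using assms(2)[of "a + 1"] by auto
  have "0 \<le> M" using M[of 0] norm_ge_zero[of "g 0"] by (simp del: norm_ge_zero)
  then have gb: "geom_bounded g"
    unfolding geom_bounded_def using M assms(1) by (intro exI[of _ M] conjI exI[of _ "a + 1"]) auto
  have "bdd_above (range (\<lambda>k. norm (kderiv k (egf g) 0) / r ^ k))" if "r > a" for r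
  proof -
    obtain M where "\<And>l. norm (g l) \<le> M * r ^ l" using assms(2)[OF \<open>r > a\<close>] by blast
    then show ?thesis
      using that assms(1) by (intro bdd_aboveI[of _ M]) (auto simp: kderiv_egf_0 gb field_simps)
  qed
  then show ?thesis by (simp add: Aspace_def holomorphic_egf gb)
qed


section \<open>Polynomials with nonpositive zeros\<close>

text \<open>The zero polynomial is excluded, since it vanishes at 1; hence the alternative of being
  0 in the statements about limits and operators.\<close>

definition nonpos_rooted :: "complex poly \<Rightarrow> bool" where
  "nonpos_rooted p \<longleftrightarrow> (\<forall>z. poly p z = 0 \<longrightarrow> z \<in> \<real>\<^sub>\<le>\<^sub>0)"

lemma nonpos_rooted_nonzero: "nonpos_rooted p \<Longrightarrow> p \<noteq> 0"
  by (auto simp: nonpos_rooted_def dest: spec[of _ 1])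

lemma nonpos_rooted_smult: "nonpos_rooted p \<Longrightarrow> c \<noteq> 0 \<Longrightarrow> nonpos_rooted (smult c p)"
  by (auto simp: nonpos_rooted_def)

text \<open>Splitting off one zero -r drives the inductions on the degree; the leading coefficient
  stays in the cofactor.\<close>

lemma nonpos_rooted_factor:
  assumes "nonpos_rooted p" "degree p > 0"
  obtains r q where "r \<ge> 0" "p = [:of_real r, 1:] * q" "nonpos_rooted q" "degree p = Suc (degree q)"
proof -
  obtain x where x: "poly p x = 0"
    using alg_closed_imp_poly_has_root[OF assms(2)] by blast
  then obtain s where s: "x = of_real s" "s \<le> 0"
    using assms(1) by (auto simp: nonpos_rooted_def elim: nonpos_Reals_cases)
  from x obtain q where q: "p = [:- x, 1:] * q"
    by (auto simp: poly_eq_0_iff_dvd elim: dvdE)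
  have "q \<noteq> 0" using q assms(2) by auto
  then have "degree p = Suc (degree q)"
    unfolding q by (subst degree_mult_eq) auto
  moreover have "nonpos_rooted q"
    using assms(1) q by (auto simp: nonpos_rooted_def)
  ultimately show thesis
    using that[of "- s" q] q s by simp
qed

text \<open>This is the pointedness of the cone spanned by 1 and z: a vanishing combination with t >
  0 would put z at the nonpositive real -s/t.\<close>

lemma of_real_add_slit_ne_0:
  fixes z :: complex
  assumes "z \<notin> \<real>\<^sub>\<le>\<^sub>0" "s \<ge> 0" "t > 0"
  shows "of_real s + of_real t * z \<noteq> 0"
proof
  assume "of_real s + of_real t * z = 0"
  then have "of_real t * z = - of_real s"
    by (simp add: eq_neg_iff_add_eq_0 add.commute)
  then have "z = of_real (- (s / t))"
    using assms(3) by (simp add: field_simps)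
  then have "z \<in> \<real>\<^sub>\<le>\<^sub>0"
    using assms(2,3) by (auto intro: nonpos_Reals_of_real_iff[THEN iffD2])
  with assms(1) show False by contradiction
qed

text \<open>Off the closed negative axis the logarithmic derivative lies in the convex cone spanned by
  \<open>1\<close> and the conjugate of \<open>z\<close>, as each \<open>1 / (z + r)\<close> does.\<close>

lemma log_deriv_in_cone:
  assumes "nonpos_rooted p" "z \<notin> \<real>\<^sub>\<le>\<^sub>0"
  shows "\<exists>s\<ge>0. \<exists>t\<ge>0. poly (pderiv p) z = poly p z * (of_real s + of_real t * cnj z)
            \<and> (degree p > 0 \<longrightarrow> t > 0)"
  using assms(1)
proof (induction "degree p" arbitrary: p)
  case 0
  then have "pderiv p = 0" by (simp add: pderiv_eq_0_iff)
  with 0 show ?case by (intro exI[of _ 0]) auto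
next
  case (Suc n)
  from Suc.prems Suc.hyps(2) obtain r q where r: "r \<ge> 0" and p: "p = [:of_real r, 1:] * q"
    and q: "nonpos_rooted q" "degree p = Suc (degree q)"
    by (auto elim: nonpos_rooted_factor)
  from Suc.hyps q obtain s t where st: "s \<ge> 0" "t \<ge> 0"
    "poly (pderiv q) z = poly q z * (of_real s + of_real t * cnj z)"
    by fastforce
  \<comment> \<open>\<open>of_real d * cnj w\<close> is 1/w, the contribution of the new factor to
    the logarithmic derivative. It adds d > 0 to the weight of \<open>cnj z\<close>, whence strict
    positivity in positive degree.\<close>
  define w where "w = of_real r + z"
  define d where "d = 1 / (cmod w)\<^sup>2"
  have "w \<noteq> 0" unfolding w_def using of_real_add_slit_ne_0[of z r 1] r assms(2) by simp
  then have d: "d > 0" by (simp add: d_def)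
  have w1: "w * (of_real d * cnj w) = 1"
    using \<open>w \<noteq> 0\<close> complex_norm_square[of w] by (simp add: d_def)
  have cw: "of_real (r * d) + of_real d * cnj z = of_real d * cnj w"
    by (simp add: w_def algebra_simps)
  have "poly (pderiv p) z = poly q z + w * poly (pderiv q) z"
    unfolding p pderiv_mult by (simp add: pderiv_pCons w_def algebra_simps)
  also have "\<dots> = poly q z * (w * (of_real d * cnj w)) + w * poly q z * (of_real s + of_real t * cnj z)"
    by (simp add: w1 st)
  also have "\<dots> = poly p z * (of_real (r * d + s) + of_real (d + t) * cnj z)"
    unfolding cw[symmetric] by (simp add: p w_def algebra_simps)
  finally have "poly (pderiv p) z = poly p z * (of_real (r * d + s) + of_real (d + t) * cnj z)" .
  then show ?case
    using r d st by (intro exI[of _ "r * d + s"] conjI exI[of _ "d + t"]) auto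
qed

lemma cnj_notin_nonpos_Reals: "z \<notin> \<real>\<^sub>\<le>\<^sub>0 \<Longrightarrow> cnj z \<notin> \<real>\<^sub>\<le>\<^sub>0"
  by (auto simp: complex_nonpos_Reals_iff)

text \<open>This is the Gauss-Lucas theorem for the negative half-line: off it, the logarithmic
  derivative has positive weight on \<open>cnj z\<close> and cannot vanish.\<close>

lemma nonpos_rooted_pderiv:
  assumes "nonpos_rooted p" "degree p > 0"
  shows "nonpos_rooted (pderiv p)"
  unfolding nonpos_rooted_def
proof (intro allI impI, rule ccontr)
  fix z assume z: "poly (pderiv p) z = 0" "z \<notin> \<real>\<^sub>\<le>\<^sub>0"
  from log_deriv_in_cone[OF assms(1) z(2)] assms(2) obtain s t where
    "s \<ge> 0" "t > 0" "poly (pderiv p) z = poly p z * (of_real s + of_real t * cnj z)"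
    by auto
  moreover have "poly p z \<noteq> 0" using assms(1) z by (auto simp: nonpos_rooted_def)
  ultimately show False
    using of_real_add_slit_ne_0[OF cnj_notin_nonpos_Reals[OF z(2)], of s t] z by simp
qed

definition DeltaP :: "real \<Rightarrow> real \<Rightarrow> complex poly \<Rightarrow> complex poly" where
  "DeltaP \<theta> \<omega> p = [:of_real \<theta>, of_real \<omega>:] * pderiv p + [:0, 1:] * pderiv (pderiv p)"

text \<open>At a zero of \<open>\<kappa> f + \<Delta> f\<close> off the negative axis, dividing by \<open>f'\<close> gives a vanishing sum of elements of
  the pointed cone spanned by \<open>1\<close> and \<open>z\<close>, so that every summand is zero.\<close>

lemma nonpos_rooted_add_DeltaP:
  assumes "nonpos_rooted f" "\<theta> \<ge> 0" "\<omega> \<ge> 0" "\<kappa> \<ge> 0"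
  defines "h \<equiv> smult (of_real \<kappa>) f + DeltaP \<theta> \<omega> f"
  shows "h = 0 \<or> nonpos_rooted h"
proof (cases "degree f = 0")
  case True
  then have "pderiv f = 0" by (simp add: pderiv_eq_0_iff)
  then have "h = smult (of_real \<kappa>) f" by (simp add: h_def DeltaP_def)
  with assms show ?thesis by (cases "\<kappa> = 0") (auto intro: nonpos_rooted_smult)
next
  case False
  show ?thesis
  proof (rule disjCI)
    assume "\<not> nonpos_rooted h"
    then obtain z where h0: "poly h z = 0" and z: "z \<notin> \<real>\<^sub>\<le>\<^sub>0"
      by (auto simp: nonpos_rooted_def)
    have f': "nonpos_rooted (pderiv f)" using assms False by (auto intro: nonpos_rooted_pderiv)
    have nz: "poly f z \<noteq> 0" "poly (pderiv f) z \<noteq> 0"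
      using assms(1) f' z by (auto simp: nonpos_rooted_def)
    from log_deriv_in_cone[OF assms(1) z] False obtain s t where st: "s \<ge> 0" "t > 0"
      "poly (pderiv f) z = poly f z * (of_real s + of_real t * cnj z)" by auto
    from log_deriv_in_cone[OF f' z] obtain s' t' where st': "s' \<ge> 0" "t' \<ge> 0"
      "poly (pderiv (pderiv f)) z = poly (pderiv f) z * (of_real s' + of_real t' * cnj z)"
      "degree (pderiv f) > 0 \<Longrightarrow> t' > 0" by auto
    \<comment> \<open>Here w = f'/f at z, so f/f' = d (s + t z): inverting conjugates the cone back
      to the span of 1 and z. In z f''/f' the conjugate is absorbed by z \<open>cnj z\<close> =
      |z|^2.\<close>
    define w where "w = of_real s + of_real t * cnj z"
    define d where "d = 1 / (cmod w)\<^sup>2"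
    have "w \<noteq> 0" using nz st by (auto simp: w_def)
    then have d: "d > 0" by (simp add: d_def)
    have w1: "w * (of_real d * cnj w) = 1"
      using \<open>w \<noteq> 0\<close> complex_norm_square[of w] by (simp add: d_def)
    have f: "poly f z = poly (pderiv f) z * (of_real d * cnj w)"
      using w1 st(3) by (simp add: w_def mult.assoc)
    have zz: "z * cnj z = of_real ((cmod z)\<^sup>2)"
      using complex_norm_square[of z] by simp
    have "poly h z = of_real \<kappa> * poly f z + (of_real \<theta> + of_real \<omega> * z) * poly (pderiv f) z
        + z * poly (pderiv (pderiv f)) z"
      by (simp add: h_def DeltaP_def algebra_simps)
    also have "\<dots> = poly (pderiv f) z *
      (of_real \<kappa> * (of_real d * cnj w) + (of_real \<theta> + of_real \<omega> * z) + (of_real s' * z + of_real t' * (z * cnj z)))"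
      unfolding f st'(3) by (simp add: algebra_simps)
    also have "of_real \<kappa> * (of_real d * cnj w) + (of_real \<theta> + of_real \<omega> * z) + (of_real s' * z + of_real t' * (z * cnj z))
      = of_real (\<kappa> * d * s + \<theta> + t' * (cmod z)\<^sup>2) + of_real (\<kappa> * d * t + \<omega> + s') * z" (is "_ = of_real ?S + of_real ?T * z")
      unfolding zz w_def by (simp add: algebra_simps)
    finally have 0: "of_real ?S + of_real ?T * z = 0"
      using h0 nz by simp
    have S: "?S \<ge> 0" and T: "?T \<ge> 0" using assms d st st' by auto
    have "\<not> ?T > 0"
      using of_real_add_slit_ne_0[OF z S, of ?T] 0 by blast
    with T have "?T = 0" by linarith
    then have "?S = 0" using 0 by (metis add.right_neutral mult_zero_left of_real_0 of_real_eq_0_iff)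
    have "\<kappa> * d * t \<ge> 0" "\<kappa> * d * s \<ge> 0" "t' * (cmod z)\<^sup>2 \<ge> 0" using assms d st st' by auto
    with \<open>?T = 0\<close> \<open>?S = 0\<close> assms st' have "\<kappa> * d * t = 0" "\<omega> = 0" "\<theta> = 0" "t' * (cmod z)\<^sup>2 = 0"
      by linarith+
    moreover have "z \<noteq> 0" using z by auto
    \<comment> \<open>Since t > 0 for nonconstant f, the weight \<kappa> d t = 0 forces \<kappa> =
      0; and t' = 0 forces f' to be constant. Then only z f'' is left of h, and it is zero.\<close>
    ultimately have "\<kappa> = 0" "\<omega> = 0" "\<theta> = 0" "degree (pderiv f) = 0"
      using d st st'(4) by auto
    then show "h = 0"
      by (simp add: h_def DeltaP_def flip: pderiv_eq_0_iff)
  qed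
qed

section \<open>Differential operators applied to polynomials\<close>

definition polyapp :: "real \<Rightarrow> real \<Rightarrow> complex poly \<Rightarrow> complex poly \<Rightarrow> complex poly" where
  "polyapp \<theta> \<omega> p f = (\<Sum>k\<le>degree p. smult (coeff p k) ((DeltaP \<theta> \<omega> ^^ k) f))"

lemma polyapp_altdef:
  assumes "degree p \<le> n"
  shows "polyapp \<theta> \<omega> p f = (\<Sum>k\<le>n. smult (coeff p k) ((DeltaP \<theta> \<omega> ^^ k) f))"
  unfolding polyapp_def using assms by (intro sum.mono_neutral_left) (auto simp: coeff_eq_0)

lemma DeltaP_add: "DeltaP \<theta> \<omega> (p + q) = DeltaP \<theta> \<omega> p + DeltaP \<theta> \<omega> q"
  unfolding DeltaP_def pderiv_add by (simp only: ring_distribs add_ac)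

lemma DeltaP_smult: "DeltaP \<theta> \<omega> (smult c p) = smult c (DeltaP \<theta> \<omega> p)"
  by (simp add: DeltaP_def pderiv_smult smult_add_right)

lemma smult_sum_right: "smult c (\<Sum>i\<in>A. g i) = (\<Sum>i\<in>A. smult c (g i))"
  by (induction A rule: infinite_finite_induct) (auto simp: smult_add_right)

lemma DeltaP_0 [simp]: "DeltaP \<theta> \<omega> 0 = 0"
  by (simp add: DeltaP_def)

lemma DeltaP_sum: "DeltaP \<theta> \<omega> (\<Sum>i\<in>A. g i) = (\<Sum>i\<in>A. DeltaP \<theta> \<omega> (g i))"
  by (induction A rule: infinite_finite_induct) (auto simp: DeltaP_add)

text \<open>In the functional calculus, multiplication by the linear factor becomes application of
  \<kappa> + \<Delta>, so the factors of \<phi> can be applied one at a time.\<close>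

lemma polyapp_linear_factor:
  "polyapp \<theta> \<omega> ([:\<kappa>, 1:] * q) f = smult \<kappa> (polyapp \<theta> \<omega> q f) + DeltaP \<theta> \<omega> (polyapp \<theta> \<omega> q f)"
proof -
  let ?n = "degree q" and ?D = "\<lambda>k. (DeltaP \<theta> \<omega> ^^ k) f"
  have "degree ([:\<kappa>, 1:] * q) \<le> Suc ?n"
    using degree_mult_le[of "[:\<kappa>, 1:]" q] by simp
  then have "polyapp \<theta> \<omega> ([:\<kappa>, 1:] * q) f = (\<Sum>k\<le>Suc ?n. smult (coeff (smult \<kappa> q + pCons 0 q) k) (?D k))"
    by (simp add: polyapp_altdef)
  also have "\<dots> = (\<Sum>k\<le>Suc ?n. smult \<kappa> (smult (coeff q k) (?D k))) + (\<Sum>k\<le>Suc ?n. smult (coeff (pCons 0 q) k) (?D k))"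
    by (simp only: coeff_add smult_add_left sum.distrib coeff_smult smult_smult)
  also have "(\<Sum>k\<le>Suc ?n. smult \<kappa> (smult (coeff q k) (?D k))) = smult \<kappa> (polyapp \<theta> \<omega> q f)"
    by (simp add: polyapp_def smult_sum_right coeff_eq_0)
  also have "(\<Sum>k\<le>Suc ?n. smult (coeff (pCons 0 q) k) (?D k)) = DeltaP \<theta> \<omega> (polyapp \<theta> \<omega> q f)"
    by (subst sum.atMost_Suc_shift) (simp add: polyapp_def DeltaP_sum DeltaP_smult)
  finally show ?thesis .
qed

lemma nonpos_rooted_polyapp:
  assumes "nonpos_rooted p" "nonpos_rooted f" "\<theta> \<ge> 0" "\<omega> \<ge> 0"
  shows "polyapp \<theta> \<omega> p f = 0 \<or> nonpos_rooted (polyapp \<theta> \<omega> p f)"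
  using assms(1)
proof (induction "degree p" arbitrary: p)
  case 0
  then obtain c where "p = [:c:]" by (metis degree_eq_zeroE)
  with nonpos_rooted_nonzero[OF 0(2)] assms show ?case by (simp add: polyapp_def nonpos_rooted_smult)
next
  case (Suc n)
  from Suc.prems Suc.hyps(2) obtain r q where r: "r \<ge> 0" and p: "p = [:of_real r, 1:] * q"
    and q: "nonpos_rooted q" "degree p = Suc (degree q)"
    by (auto elim: nonpos_rooted_factor)
  from Suc.hyps q have "polyapp \<theta> \<omega> q f = 0 \<or> nonpos_rooted (polyapp \<theta> \<omega> q f)" by auto
  then show ?case
    unfolding p polyapp_linear_factor using nonpos_rooted_add_DeltaP[OF _ assms(3,4) r] by auto
qed

text \<open>The derivatives of p at 0, written through coefficients; this is the polynomial
  counterpart of \<open>kderiv l f 0\<close>.\<close>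

definition cseq :: "complex poly \<Rightarrow> nat \<Rightarrow> complex" where
  "cseq p l = fact l * coeff p l"

lemma egf_cseq: "egf (cseq p) z = poly p z"
proof -
  have "egf (cseq p) z = (\<Sum>l. coeff p l * z ^ l)"
    by (simp add: egf_def cseq_def)
  also have "\<dots> = (\<Sum>l\<le>degree p. coeff p l * z ^ l)"
    by (rule suminf_finite) (auto simp: coeff_eq_0)
  finally show ?thesis by (simp add: poly_altdef)
qed

lemma cseq_DeltaP: "cseq (DeltaP \<theta> \<omega> p) = opT \<theta> \<omega> (cseq p)"
proof
  fix l
  show "cseq (DeltaP \<theta> \<omega> p) l = opT \<theta> \<omega> (cseq p) l"
    by (cases l)
       (simp_all add: cseq_def DeltaP_def opT_def coeff_pderiv scaleR_conv_of_real algebra_simps)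
qed

lemma cseq_DeltaP_funpow: "cseq ((DeltaP \<theta> \<omega> ^^ k) p) = (opT \<theta> \<omega> ^^ k) (cseq p)"
  by (induction k) (auto simp: cseq_DeltaP)

lemma cseq_polyapp: "cseq (polyapp \<theta> \<omega> p f) = opcoef \<theta> \<omega> (cseq p) (cseq f)"
proof
  fix l
  have "opcoef \<theta> \<omega> (cseq p) (cseq f) l = (\<Sum>k. coeff p k * cseq ((DeltaP \<theta> \<omega> ^^ k) f) l)"
    by (simp add: opcoef_def cseq_DeltaP_funpow) (simp add: cseq_def)
  also have "\<dots> = (\<Sum>k\<le>degree p. coeff p k * cseq ((DeltaP \<theta> \<omega> ^^ k) f) l)"
    by (rule suminf_finite) (auto simp: coeff_eq_0)
  also have "\<dots> = cseq (polyapp \<theta> \<omega> p f) l"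
    by (simp add: polyapp_def cseq_def coeff_sum sum_distrib_left mult_ac)
  finally show "cseq (polyapp \<theta> \<omega> p f) l = opcoef \<theta> \<omega> (cseq p) (cseq f) l" ..
qed


section \<open>Laguerre functions as limits of polynomials\<close>

definition nonneg_poly :: "complex poly \<Rightarrow> bool" where
  "nonneg_poly p \<longleftrightarrow> (\<forall>k. coeff p k \<in> \<real>\<^sub>\<ge>\<^sub>0)"

lemma nonneg_poly_add: "nonneg_poly p \<Longrightarrow> nonneg_poly q \<Longrightarrow> nonneg_poly (p + q)"
  by (simp add: nonneg_poly_def)

lemma nonneg_poly_mult: "nonneg_poly p \<Longrightarrow> nonneg_poly q \<Longrightarrow> nonneg_poly (p * q)"
proof -
  have sum: "(\<And>i. i \<in> A \<Longrightarrow> g i \<in> \<real>\<^sub>\<ge>\<^sub>0) \<Longrightarrow> sum g A \<in> \<real>\<^sub>\<ge>\<^sub>0" for g :: "nat \<Rightarrow> complex" and A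
    by (induction A rule: infinite_finite_induct) auto
  show "nonneg_poly p \<Longrightarrow> nonneg_poly q \<Longrightarrow> nonneg_poly (p * q)"
    unfolding nonneg_poly_def coeff_mult by (auto intro!: sum nonneg_Reals_mult_I)
qed

lemma nonneg_poly_linear: "s \<ge> 0 \<Longrightarrow> t \<ge> 0 \<Longrightarrow> nonneg_poly [:of_real s, of_real t:]"
  by (auto simp: nonneg_poly_def coeff_pCons split: nat.splits)

lemma nonneg_poly_0 [simp]: "nonneg_poly 0" and nonneg_poly_1 [simp]: "nonneg_poly 1"
  by (auto simp: nonneg_poly_def)

text \<open>The coefficientwise order, with both sides nonnegative so that it is compatible with
  products and powers.\<close>

definition poly_dominated :: "complex poly \<Rightarrow> complex poly \<Rightarrow> bool" where
  "poly_dominated p q \<longleftrightarrow> nonneg_poly p \<and> nonneg_poly q \<and> nonneg_poly (q - p)"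

lemma poly_dominated_mult:
  assumes "poly_dominated p q" "poly_dominated p' q'"
  shows "poly_dominated (p * p') (q * q')"
proof -
  have eq: "q * q' - p * p' = q * (q' - p') + (q - p) * p'" by (simp add: algebra_simps)
  show ?thesis
    unfolding poly_dominated_def eq using assms
    by (auto simp: poly_dominated_def intro: nonneg_poly_mult nonneg_poly_add)
qed

lemma poly_dominated_refl: "nonneg_poly p \<Longrightarrow> poly_dominated p p"
  by (simp add: poly_dominated_def)

text \<open>The square exceeds 1 + t z by t^2 z^2 / 4. With t = \<alpha> / 2^n and after raising to
  the power 2^n, this compares consecutive approximants of the exponential.\<close>

lemma poly_dominated_square:
  assumes "t \<ge> 0"
  shows "poly_dominated [:of_real 1, of_real t:] ([:of_real 1, of_real (t / 2):]\<^sup>2)"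
proof -
  have eq: "[:of_real 1, of_real (t / 2):]\<^sup>2 - [:of_real 1, of_real t:]
      = [:of_real 0, of_real 1:] * ([:of_real 0, of_real 1:] * ([:of_real (t\<^sup>2 / 4), of_real 0:] :: complex poly))"
    by (simp add: power2_eq_square)
  show ?thesis
    unfolding poly_dominated_def eq unfolding power2_eq_square using assms
    by (intro conjI nonneg_poly_mult nonneg_poly_linear) auto
qed

lemma poly_dominated_power: "poly_dominated p q \<Longrightarrow> poly_dominated (p ^ n) (q ^ n)"
  by (induction n) (auto intro: poly_dominated_mult poly_dominated_refl)

text \<open>Monotone convergence of coefficients: at a point y >= 0 the terms of \<open>P n\<close>
  are nonnegative and their sum converges as n grows, which bounds them uniformly in n. Hence the
  coefficients have limits that dominate them, and the limit series converges at every y.\<close>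

lemma monotone_poly_limit:
  assumes nn: "\<And>n. poly_dominated (P n) (P (Suc n))"
    and lim: "\<And>z. (\<lambda>n. poly (P n) z) \<longlonglongrightarrow> f z"
  obtains e where "\<And>k. (\<lambda>n. coeff (P n) k) \<longlonglongrightarrow> e k" "\<And>n k. norm (coeff (P n) k) \<le> norm (e k)"
    "\<And>z. (\<lambda>k. e k * z ^ k) sums f z"
proof -
  define x where "x = (\<lambda>n k. Re (coeff (P n) k))"
  have nP: "coeff (P n) k \<in> \<real>\<^sub>\<ge>\<^sub>0" "coeff (P (Suc n)) k - coeff (P n) k \<in> \<real>\<^sub>\<ge>\<^sub>0" for n k
    using nn[of n] by (auto simp: poly_dominated_def nonneg_poly_def)
  have x: "coeff (P n) k = of_real (x n k)" "0 \<le> x n k" for n k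
    using nP(1)[of n k] by (auto simp: x_def complex_nonneg_Reals_iff complex_eq_iff)
  have mono: "incseq (\<lambda>n. x n k)" for k
    using nP(2) by (intro incseq_SucI) (simp add: x_def complex_nonneg_Reals_iff)
  have xsum: "\<exists>B. \<forall>K n. (\<Sum>k<K. x n k * y ^ k) \<le> B" if y: "y \<ge> 0" for y
  proof -
    have "Bseq (\<lambda>n. poly (P n) (of_real y))"
      using lim convergentI convergent_imp_Bseq by blast
    then obtain B where B: "\<And>n. norm (poly (P n) (of_real y)) \<le> B" by (auto simp: Bseq_def)
    have "(\<Sum>k<K. x n k * y ^ k) \<le> B" for K n
    proof -
      have "(\<Sum>k<K. x n k * y ^ k) \<le> (\<Sum>k\<in>{..<K} \<union> {..degree (P n)}. x n k * y ^ k)"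
        using x y by (intro sum_mono2) auto
      also have "\<dots> = (\<Sum>k\<le>degree (P n). x n k * y ^ k)"
        by (intro sum.mono_neutral_right) (auto simp: x_def coeff_eq_0)
      also have "of_real \<dots> = poly (P n) (of_real y)"
        by (simp add: poly_altdef x)
      then have "(\<Sum>k\<le>degree (P n). x n k * y ^ k) \<le> norm (poly (P n) (of_real y))"
        by (metis abs_ge_self norm_of_real)
      finally show ?thesis using B[of n] by linarith
    qed
    then show ?thesis by blast
  qed
  have "\<exists>e. (\<lambda>n. x n k) \<longlonglongrightarrow> e" for k
  proof -
    obtain B where B: "\<And>K n. (\<Sum>k<K. x n k * 1 ^ k) \<le> B" using xsum[of 1] by auto
    have "x n k \<le> B" for n
      using member_le_sum[of k "{..<Suc k}" "x n"] x(2) B[where K="Suc k" and n=n] by simp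
    then show ?thesis using incseq_convergent[OF mono] by metis
  qed
  then obtain e where e: "\<And>k. (\<lambda>n. x n k) \<longlonglongrightarrow> e k" by metis
  have xe: "x n k \<le> e k" for n k by (rule incseq_le[OF mono e])
  have e0: "0 \<le> e k" for k using xe[of 0 k] x(2)[of 0 k] by linarith
  have se: "summable (\<lambda>k. e k * y ^ k)" if y: "y \<ge> 0" for y
  proof -
    obtain B where B: "\<And>K n. (\<Sum>k<K. x n k * y ^ k) \<le> B" using xsum y by blast
    have "(\<Sum>k<K. e k * y ^ k) \<le> B" for K
      by (rule LIMSEQ_le_const2[of "\<lambda>n. \<Sum>k<K. x n k * y ^ k"]) (use B in \<open>auto intro!: tendsto_intros e\<close>)
    then show ?thesis
      using e0 y by (intro bounded_imp_summable[where B=B]) (auto simp flip: lessThan_Suc_atMost simp del: sum.lessThan_Suc)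
  qed
  show thesis
  proof (rule that[of "\<lambda>k. of_real (e k)"])
    show "(\<lambda>n. coeff (P n) k) \<longlonglongrightarrow> of_real (e k)" for k
      unfolding x by (intro tendsto_of_real e)
    show "norm (coeff (P n) k) \<le> norm (complex_of_real (e k))" for n k
      using x(2)[of n k] xe[of n k] by (simp add: x(1))
    fix z
    have T: "(\<lambda>n. \<Sum>k. coeff (P n) k * z ^ k) \<longlonglongrightarrow> (\<Sum>k. of_real (e k) * z ^ k)"
    proof (rule tannery_sequentially(2)[OF _ _ se[of "norm z"]])
      show "(\<lambda>n. coeff (P n) k * z ^ k) \<longlonglongrightarrow> of_real (e k) * z ^ k" for k
        unfolding x by (intro tendsto_intros e)
      show "norm (coeff (P n) k * z ^ k) \<le> e k * norm z ^ k" for k n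
        using x(2)[of n k] xe[of n k] by (simp add: x(1) norm_mult norm_power mult_right_mono)
    qed auto
    have "(\<Sum>k. coeff (P n) k * z ^ k) = poly (P n) z" for n
      unfolding poly_altdef by (rule suminf_finite) (auto simp: coeff_eq_0)
    with T lim[of z] have "(\<Sum>k. of_real (e k) * z ^ k) = f z"
      by (auto intro: LIMSEQ_unique)
    moreover have "summable (\<lambda>k. of_real (e k) * z ^ k)"
      by (rule summable_comparison_test[OF _ se[of "norm z"]]) (use e0 in \<open>auto simp: norm_mult norm_power\<close>)
    ultimately show "(\<lambda>k. of_real (e k) * z ^ k) sums f z"
      by (auto simp: sums_iff)
  qed
qed

lemma power_series_eq_kderiv:
  assumes "\<And>z. (\<lambda>k. e k * z ^ k) sums f z"
  shows "kderiv k f 0 = fact k * e k"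
proof -
  have 1: "summable (\<lambda>k. e k * 1 ^ k)" using assms sums_summable by blast
  have "f has_fps_expansion Abs_fps e"
    unfolding has_fps_expansion_def
  proof
    show "fps_conv_radius (Abs_fps e) > 0"
      using conv_radius_geI[OF 1] less_le_trans[of 0 "1::ereal"]
      by (simp add: fps_conv_radius_def one_ereal_def)
    show "\<forall>\<^sub>F z in nhds 0. eval_fps (Abs_fps e) z = f z"
      using assms by (intro always_eventually) (auto simp: eval_fps_def sums_iff)
  qed
  from fps_nth_fps_expansion[OF this, of k] show ?thesis by (simp add: kderiv_def)
qed

lemma exp_limit_dyadic: "(\<lambda>n. (1 + w / 2 ^ n) ^ (2 ^ n)) \<longlonglongrightarrow> exp w" for w :: complex
proof -
  have u0: "(\<lambda>n. 1 / 2 ^ n :: complex) \<longlonglongrightarrow> 0"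
    using LIMSEQ_power_zero[of "1/2 :: complex"] by (simp add: power_divide norm_divide)
  \<comment> \<open>The difference quotient of Ln (1 + u w) at u = 0, taken along u = 1/2^n, is 2^n
    Ln (1 + w / 2^n).\<close>
  have "((\<lambda>u. Ln (1 + u * w)) has_field_derivative w) (at 0)"
    by (auto intro!: derivative_eq_intros)
  then have "((\<lambda>u. Ln (1 + u * w) / u) \<longlongrightarrow> w) (at 0)"
    by (simp add: has_field_derivative_iff)
  moreover have "filterlim (\<lambda>n. 1 / 2 ^ n :: complex) (at 0) sequentially"
    using u0 by (auto simp: filterlim_at)
  ultimately have L: "(\<lambda>n. Ln (1 + 1 / 2 ^ n * w) / (1 / 2 ^ n)) \<longlonglongrightarrow> w"
    by (rule filterlim_compose)
  have "(\<lambda>n. 1 + 1 / 2 ^ n * w) \<longlonglongrightarrow> 1 + 0 * w"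
    by (intro tendsto_intros u0)
  then have "eventually (\<lambda>n. 1 + 1 / 2 ^ n * w \<noteq> 0) sequentially"
    by (rule tendsto_imp_eventually_ne) simp
  then have "eventually (\<lambda>n. exp (Ln (1 + 1 / 2 ^ n * w) / (1 / 2 ^ n)) = (1 + w / 2 ^ n) ^ (2 ^ n)) sequentially"
  proof eventually_elim
    case (elim n)
    then show ?case
      using exp_of_nat_mult[of "2 ^ n" "Ln (1 + 1 / 2 ^ n * w)"] by (simp add: mult.commute)
  qed
  with tendsto_exp[OF L] show ?thesis by (rule Lim_transform_eventually)
qed

lemma convergent_prod_linear:
  fixes z :: complex
  assumes "summable (\<beta> :: nat \<Rightarrow> real)" "\<And>j. \<beta> j \<ge> 0"
  shows "convergent_prod (\<lambda>j. 1 + of_real (\<beta> j) * z)"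
proof -
  have "summable (\<lambda>j. \<beta> j * norm z)"
    using assms by (intro summable_mult2)
  then have "summable (\<lambda>j. norm (1 + of_real (\<beta> j) * z - 1))"
    using assms(2) by (simp add: norm_mult)
  then show ?thesis
    by (intro abs_convergent_prod_imp_convergent_prod summable_imp_abs_convergent_prod)
qed

lemma nonpos_rooted_mult: "nonpos_rooted p \<Longrightarrow> nonpos_rooted q \<Longrightarrow> nonpos_rooted (p * q)"
  by (auto simp: nonpos_rooted_def)

lemma nonpos_rooted_1 [simp]: "nonpos_rooted 1"
  by (simp add: nonpos_rooted_def)

lemma nonpos_rooted_X: "nonpos_rooted [:of_real 0, of_real 1:]"
  by (simp add: nonpos_rooted_def)

lemma nonpos_rooted_linear: "t \<ge> 0 \<Longrightarrow> nonpos_rooted [:of_real 1, of_real t:]"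
  unfolding nonpos_rooted_def
proof (intro allI impI, rule ccontr)
  fix z :: complex assume t: "t \<ge> 0" "poly [:of_real 1, of_real t:] z = 0" and "z \<notin> \<real>\<^sub>\<le>\<^sub>0"
  then show False using of_real_add_slit_ne_0[of z 1 t] by (cases "t = 0") (auto simp: mult.commute)
qed

lemma nonpos_rooted_power: "nonpos_rooted p \<Longrightarrow> nonpos_rooted (p ^ n)"
  by (induction n) (auto intro: nonpos_rooted_mult)

lemma nonpos_rooted_prod: "(\<And>i. i \<in> A \<Longrightarrow> nonpos_rooted (g i)) \<Longrightarrow> nonpos_rooted (\<Prod>i\<in>A. g i)"
  by (induction A rule: infinite_finite_induct) (auto intro: nonpos_rooted_mult)

text \<open>With \<open>2\<^sup>n\<close>-th powers, the coefficients of the approximants of \<open>exp (\<alpha> z)\<close> increase with \<open>n\<close>.\<close>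

lemma Laguerre_product_approx:
  assumes "\<alpha> \<ge> 0" and \<beta>: "\<And>j. \<beta> j \<ge> 0" "summable \<beta>"
  obtains Q e where "\<And>n. nonpos_rooted (Q n)" "\<And>k. (\<lambda>n. coeff (Q n) k) \<longlonglongrightarrow> e k"
    "\<And>n k. norm (coeff (Q n) k) \<le> norm (e k)"
    "\<And>z. (\<lambda>k. e k * z ^ k) sums (z ^ m * exp (of_real \<alpha> * z) * (\<Prod>j. 1 + of_real (\<beta> j) * z))"
proof -
  define Q :: "nat \<Rightarrow> complex poly" where "Q = (\<lambda>n. [:of_real 0, of_real 1:] ^ m *
    [:of_real 1, of_real (\<alpha> / 2 ^ n):] ^ (2 ^ n) * (\<Prod>j<n. [:of_real 1, of_real (\<beta> j):]))"
  have lin: "nonneg_poly [:of_real 1, of_real (\<alpha> / 2 ^ n):]" "nonneg_poly [:of_real 1, of_real (\<beta> j):]" for n j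
    using \<open>\<alpha> \<ge> 0\<close> \<beta> by (auto intro!: nonneg_poly_linear simp del: of_real_1 of_real_divide)
  have dom: "poly_dominated (Q n) (Q (Suc n))" for n
  proof -
    have "poly_dominated [:of_real 1, of_real (\<alpha> / 2 ^ n):] ([:of_real 1, of_real (\<alpha> / 2 ^ Suc n):]\<^sup>2)"
      using poly_dominated_square[of "\<alpha> / 2 ^ n"] \<open>\<alpha> \<ge> 0\<close> by (simp add: mult.commute del: of_real_divide)
    then have "poly_dominated ([:of_real 1, of_real (\<alpha> / 2 ^ n):] ^ (2 ^ n))
        ([:of_real 1, of_real (\<alpha> / 2 ^ Suc n):] ^ (2 ^ Suc n))"
      using poly_dominated_power[of _ _ "2 ^ n"] by (fastforce simp flip: power_mult)
    moreover have "poly_dominated (\<Prod>j<n. [:of_real 1, of_real (\<beta> j):]) (\<Prod>j<Suc n. [:of_real 1, of_real (\<beta> j):])"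
    proof -
      have nn: "nonneg_poly (\<Prod>j<n. [:of_real 1, of_real (\<beta> j):])"
        by (induction n) (auto intro: nonneg_poly_mult lin simp del: of_real_1 mult_pCons_right mult_pCons_left)
      have "poly_dominated 1 [:of_real 1, of_real (\<beta> n):]"
        using lin(2)[of n] nonneg_poly_linear[of 0 "\<beta> n"] nonneg_poly_linear[of 1 0] \<beta>
        by (simp add: poly_dominated_def one_pCons)
      from poly_dominated_mult[OF poly_dominated_refl[OF nn] this] show ?thesis by simp
    qed
    moreover have "poly_dominated ([:of_real 0, of_real 1:] ^ m) ([:of_real 0, of_real 1:] ^ m)"
      by (intro poly_dominated_power poly_dominated_refl nonneg_poly_linear) auto
    ultimately show ?thesis unfolding Q_def by (intro poly_dominated_mult)
  qed
  have lim: "(\<lambda>n. poly (Q n) z) \<longlonglongrightarrow> z ^ m * exp (of_real \<alpha> * z) * (\<Prod>j. 1 + of_real (\<beta> j) * z)" for z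
  proof -
    have "(\<lambda>n. z ^ m * (1 + (of_real \<alpha> * z) / 2 ^ n) ^ (2 ^ n) * (\<Prod>j<n. 1 + of_real (\<beta> j) * z))
        \<longlonglongrightarrow> z ^ m * exp (of_real \<alpha> * z) * (\<Prod>j. 1 + of_real (\<beta> j) * z)"
      by (intro tendsto_intros exp_limit_dyadic has_prod_imp_tendsto' convergent_prod_has_prod
          convergent_prod_linear \<beta>)
    then show ?thesis by (simp add: Q_def poly_prod mult_ac)
  qed
  obtain e where e: "\<And>k. (\<lambda>n. coeff (Q n) k) \<longlonglongrightarrow> e k" "\<And>n k. norm (coeff (Q n) k) \<le> norm (e k)"
    "\<And>z. (\<lambda>k. e k * z ^ k) sums (z ^ m * exp (of_real \<alpha> * z) * (\<Prod>j. 1 + of_real (\<beta> j) * z))"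
    by (rule monotone_poly_limit[OF dom lim]) (rule that)
  have Qr: "nonpos_rooted (Q n)" for n
    unfolding Q_def using \<beta> \<open>\<alpha> \<ge> 0\<close>
    by (intro nonpos_rooted_mult nonpos_rooted_prod nonpos_rooted_power nonpos_rooted_X
        nonpos_rooted_linear) auto
  show thesis by (rule that[OF Qr e])
qed

text \<open>Domination by the derivatives of f itself makes the approximants inherit every bound
  valid for f. The complex constant \<open>C\<close> is multiplied in only at the end, since the
  approximation rests on nonnegative coefficients.\<close>

lemma Laguerre_approx:
  assumes "f \<in> Laguerre"
  obtains P where "\<And>n. P n = 0 \<or> nonpos_rooted (P n)"
    "\<And>k. (\<lambda>n. cseq (P n) k) \<longlonglongrightarrow> kderiv k f 0"
    "\<And>n k. norm (cseq (P n) k) \<le> norm (kderiv k f 0)"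
proof -
  from assms obtain C m \<alpha> \<beta> where \<alpha>: "\<alpha> \<ge> 0" and \<beta>: "\<And>j. \<beta> j \<ge> 0" "summable \<beta>"
    and f: "\<And>z. f z = C * z ^ m * exp (of_real \<alpha> * z) * (\<Prod>j. 1 + of_real (\<beta> j) * z)"
    unfolding Laguerre_def by blast
  obtain Q e where Qr: "\<And>n. nonpos_rooted (Q n)" and e: "\<And>k. (\<lambda>n. coeff (Q n) k) \<longlonglongrightarrow> e k"
    "\<And>n k. norm (coeff (Q n) k) \<le> norm (e k)"
    "\<And>z. (\<lambda>k. e k * z ^ k) sums (z ^ m * exp (of_real \<alpha> * z) * (\<Prod>j. 1 + of_real (\<beta> j) * z))"
    by (rule Laguerre_product_approx[OF \<alpha> \<beta>, where m = m]) (rule that)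
  have kd: "kderiv k f 0 = fact k * (C * e k)" for k
    by (rule power_series_eq_kderiv) (use sums_mult[OF e(3), of C] f in \<open>simp add: mult_ac\<close>)
  show thesis
  proof (rule that[of "\<lambda>n. smult C (Q n)"])
    show "smult C (Q n) = 0 \<or> nonpos_rooted (smult C (Q n))" for n
      using Qr[of n] by (cases "C = 0") (auto intro: nonpos_rooted_smult)
    show "(\<lambda>n. cseq (smult C (Q n)) k) \<longlonglongrightarrow> kderiv k f 0" for k
      unfolding kd cseq_def coeff_smult by (intro tendsto_intros e)
    show "norm (cseq (smult C (Q n)) k) \<le> norm (kderiv k f 0)" for n k
      unfolding kd cseq_def coeff_smult norm_mult by (intro mult_left_mono e) auto
  qed
qed


section \<open>Limits of polynomials with nonpositive zeros\<close>

lemma nonpos_rooted_nonneg_coeffs: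
  assumes "nonpos_rooted p"
  obtains c q where "p = smult c q" "nonneg_poly q"
proof -
  from assms have "\<exists>c q. p = smult c q \<and> nonneg_poly q"
  proof (induction "degree p" arbitrary: p)
    case 0
    then obtain c where "p = [:c:]" by (metis degree_eq_zeroE)
    then have "p = smult c 1" by (simp add: one_pCons)
    then show ?case using nonneg_poly_1 by blast
  next
    case (Suc n)
    from Suc.prems Suc.hyps(2) obtain r p' where r: "r \<ge> 0" and p: "p = [:of_real r, 1:] * p'"
      and p': "nonpos_rooted p'" "degree p = Suc (degree p')"
      by (auto elim: nonpos_rooted_factor)
    from Suc.hyps p' obtain c q where "p' = smult c q" "nonneg_poly q" by fastforce
    then have "p = smult c ([:of_real r, of_real 1:] * q)" "nonneg_poly ([:of_real r, of_real 1:] * q)"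
      using nonneg_poly_mult[OF nonneg_poly_linear[of r 1]] r
      by (auto simp: p mult_smult_right simp del: mult_pCons_left)
    then show ?case by blast
  qed
  then show thesis using that by blast
qed

text \<open>Nonnegative coefficients up to a common factor exclude cancellation at 1.\<close>

lemma norm_coeff_le_norm_poly_1:
  assumes "nonpos_rooted p"
  shows "norm (coeff p k) \<le> norm (poly p 1)"
proof -
  obtain c q where p: "p = smult c q" and q: "nonneg_poly q"
    using assms by (rule nonpos_rooted_nonneg_coeffs)
  have q': "coeff q k = of_real (Re (coeff q k))" "0 \<le> Re (coeff q k)" for k
    using q by (auto simp: nonneg_poly_def complex_nonneg_Reals_iff complex_eq_iff)
  have "poly q 1 = (\<Sum>k\<le>degree q. coeff q k)" by (simp add: poly_altdef)
  also have "\<dots> = of_real (\<Sum>k\<le>degree q. Re (coeff q k))"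
    using q' by simp
  finally have "norm (poly q 1) = (\<Sum>k\<le>degree q. Re (coeff q k))"
    using q' by (simp add: sum_nonneg del: of_real_sum)
  moreover have "Re (coeff q k) \<le> (\<Sum>k\<le>degree q. Re (coeff q k))"
    using q' by (cases "k \<le> degree q") (auto intro!: member_le_sum sum_nonneg simp: coeff_eq_0)
  moreover have "norm (coeff q k) = Re (coeff q k)"
    using q'[of k] by (metis abs_of_nonneg norm_of_real)
  ultimately show ?thesis
    by (simp add: p norm_mult mult_left_mono)
qed

text \<open>A zero -r gives r + 1 + w = (1 + r) (1 + w / (1 + r)), so g = 1 corresponds to a zero at
  the origin. The second identity is p'/p = sum of 1 / (z + r), evaluated at z = 1.\<close>

lemma nonpos_rooted_list_factorization:
  assumes "nonpos_rooted p"
  shows "\<exists>gs :: real list. set gs \<subseteq> {0..1} \<and> (\<forall>w. poly p (1 + w) = poly p 1 * (\<Prod>g\<leftarrow>gs. 1 + of_real g * w))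
      \<and> poly (pderiv p) 1 = poly p 1 * of_real (sum_list gs)"
  using assms
proof (induction "degree p" arbitrary: p)
  case 0
  then obtain c where "p = [:c:]" by (metis degree_eq_zeroE)
  then show ?case by (intro exI[of _ "[]"]) (auto simp: pderiv_pCons)
next
  case (Suc n)
  from Suc.prems Suc.hyps(2) obtain r q where r: "r \<ge> 0" and p: "p = [:of_real r, 1:] * q"
    and q: "nonpos_rooted q" "degree p = Suc (degree q)"
    by (auto elim: nonpos_rooted_factor)
  from Suc.hyps q obtain gs where gs: "set gs \<subseteq> {0..1}"
    "\<And>w. poly q (1 + w) = poly q 1 * (\<Prod>g\<leftarrow>gs. 1 + of_real g * w)"
    "poly (pderiv q) 1 = poly q 1 * of_real (sum_list gs)"
    by fastforce
  define t where "t = 1 / (1 + r)"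
  have t: "t \<in> {0..1}" using r by (auto simp: t_def)
  have rt: "(of_real r + 1) * of_real t = (1 :: complex)"
  proof -
    have "(r + 1) * t = 1" using r by (simp add: t_def add.commute)
    then have "complex_of_real ((r + 1) * t) = of_real 1" by (simp only:)
    then show ?thesis by (simp only: of_real_mult of_real_add of_real_1)
  qed
  show ?case
  proof (intro exI[of _ "t # gs"] conjI allI)
    show "set (t # gs) \<subseteq> {0..1}" using t gs by auto
    fix w
    have "poly p (1 + w) = ((of_real r + 1) + w) * poly q (1 + w)"
      by (simp add: p algebra_simps)
    also have "(of_real r + 1) + w = (of_real r + 1) * (1 + of_real t * w)"
      by (simp add: distrib_left rt flip: mult.assoc)
    finally show "poly p (1 + w) = poly p 1 * (\<Prod>g\<leftarrow>(t # gs). 1 + of_real g * w)"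
      by (simp add: p gs(2) algebra_simps)
  next
    have "poly (pderiv p) 1 = poly q 1 + (of_real r + 1) * poly (pderiv q) 1"
      unfolding p pderiv_mult by (simp add: pderiv_pCons algebra_simps)
    also have "\<dots> = (of_real r + 1) * of_real t * poly q 1 + (of_real r + 1) * (poly q 1 * of_real (sum_list gs))"
      by (simp only: rt gs mult_1_left)
    also have "\<dots> = poly p 1 * of_real (sum_list (t # gs))"
      by (simp add: p algebra_simps)
    finally show "poly (pderiv p) 1 = poly p 1 * of_real (sum_list (t # gs))" .
  qed
qed

text \<open>Sorting lets the j-th entry be controlled by the sum and makes coordinatewise limits
  decreasing. Padding with 0 adds only factors 1 and gives polynomials of different degrees a common
  index set.\<close>

lemma nonpos_rooted_sorted_factorization:
  assumes "nonpos_rooted p"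
  shows "\<exists>(g :: nat \<Rightarrow> real) N. decseq g \<and> (\<forall>j. g j \<in> {0..1}) \<and> (\<forall>j\<ge>N. g j = 0)
      \<and> (\<forall>w. poly p (1 + w) = poly p 1 * (\<Prod>j<N. 1 + of_real (g j) * w))
      \<and> poly (pderiv p) 1 = poly p 1 * of_real (\<Sum>j<N. g j)"
proof -
  obtain gs :: "real list" where gs: "set gs \<subseteq> {0..1}"
    "\<And>w. poly p (1 + w) = poly p 1 * (\<Prod>g\<leftarrow>gs. 1 + of_real g * w)"
    "poly (pderiv p) 1 = poly p 1 * of_real (sum_list gs)"
    using nonpos_rooted_list_factorization[OF assms] by blast
  define hs where "hs = rev (sort gs)"
  define N where "N = length hs"
  define g where "g = (\<lambda>j. if j < N then hs ! j else 0)"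
  have set: "set hs \<subseteq> {0..1}" using gs(1) by (simp add: hs_def)
  have mset: "mset hs = mset gs" by (simp add: hs_def)
  have g01: "g j \<in> {0..1}" for j
    using set nth_mem[of j hs] unfolding g_def N_def by (cases "j < length hs") (force, simp)
  have "g (Suc j) \<le> g j" for j
  proof (cases "Suc j < N")
    case True
    have "sorted_wrt (\<ge>) hs" unfolding hs_def by (simp add: sorted_wrt_rev)
    with True show ?thesis
      using sorted_wrt_nth_less[of "(\<ge>)" hs j "Suc j"] by (auto simp: g_def N_def)
  next
    case False
    with g01[of j] show ?thesis by (auto simp: g_def)
  qed
  then have "decseq g" by (rule decseq_SucI)
  moreover have "(\<Prod>g\<leftarrow>gs. 1 + of_real g * w) = (\<Prod>j<N. 1 + of_real (g j) * w)" for w :: complex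
  proof -
    have "(\<Prod>g\<leftarrow>gs. 1 + of_real g * w) = (\<Prod>g\<leftarrow>hs. 1 + of_real g * w)"
      using mset by (metis mset_map prod_mset_prod_list)
    also have "\<dots> = (\<Prod>j<N. 1 + of_real (g j) * w)"
      by (simp add: prod.list_conv_set_nth g_def N_def lessThan_atLeast0)
    finally show ?thesis .
  qed
  moreover have "sum_list gs = (\<Sum>j<N. g j)"
  proof -
    have "sum_list gs = sum_list hs" using mset by (metis sum_mset_sum_list)
    also have "\<dots> = (\<Sum>j<N. g j)"
      by (simp add: sum.list_conv_set_nth g_def N_def lessThan_atLeast0)
    finally show ?thesis .
  qed
  ultimately show ?thesis
    using gs g01 by (intro exI[of _ g] exI[of _ N]) (auto simp: g_def)
qed

text \<open>A product of linear factors converges along a subsequence after splitting off the exponential of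
  the first-order terms, since the remaining logarithms are dominated by a convergent series of squares.\<close>

definition ln_remainder :: "complex \<Rightarrow> complex" where
  "ln_remainder u = Ln (1 + u) - u"

lemma norm_ln_remainder_le:
  assumes "norm u \<le> 1 / 2" shows "norm (ln_remainder u) \<le> 2 * (norm u)\<^sup>2"
proof -
  have "norm (ln_remainder u) \<le> (norm u)\<^sup>2 / (1 - norm u)"
    unfolding ln_remainder_def using assms by (intro Ln_approx_linear) auto
  also have "\<dots> \<le> (norm u)\<^sup>2 / (1 / 2)"
    using assms by (intro divide_left_mono) auto
  finally show ?thesis by simp
qed

lemma one_plus_notin_nonpos_Reals: "norm u < 1 \<Longrightarrow> 1 + u \<notin> \<real>\<^sub>\<le>\<^sub>0" for u :: complex
  using abs_Re_le_cmod[of u] by (auto simp: complex_nonpos_Reals_iff)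

lemma prod_linear_eq_exp:
  fixes u :: "nat \<Rightarrow> complex"
  assumes "\<And>j. norm (u j) \<le> 1 / 2"
  shows "(\<Prod>j<N. 1 + u j) = exp (\<Sum>j<N. u j) * exp (\<Sum>j<N. ln_remainder (u j))"
proof -
  have eq: "1 + u j = exp (u j + ln_remainder (u j))" for j
    using one_plus_notin_nonpos_Reals[of "u j"] assms[of j]
    by (subst ln_remainder_def) (auto intro!: exp_Ln[symmetric])
  show ?thesis
    unfolding eq by (simp add: exp_sum prod.distrib exp_add)
qed

lemma ln_remainder_dominated:
  assumes g: "decseq g" "\<And>j. g j \<in> {0..1}" "\<And>K. (\<Sum>j<K. g j) \<le> B" and w: "norm w \<le> 1 / 2"
  shows "norm (of_real (g j) * w) \<le> 1 / 2"
    and "norm (ln_remainder (of_real (g j) * w)) \<le> 2 * B\<^sup>2 * inverse (real (Suc j) ^ 2)"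
proof -
  have "norm (of_real (g j) * w) \<le> 1 * (1 / 2)"
    unfolding norm_mult using g(2)[of j] w by (intro mult_mono) auto
  then show 1: "norm (of_real (g j) * w) \<le> 1 / 2" by simp
  \<comment> \<open>Each of the first j + 1 entries is at least g j, whence g j <= B / (j + 1); the
    squares are then summable, uniformly over all sequences with sums bounded by B.\<close>
  have "real (Suc j) * g j = (\<Sum>i<Suc j. g j)" by simp
  also have "\<dots> \<le> (\<Sum>i<Suc j. g i)"
    by (intro sum_mono decseqD[OF g(1)]) auto
  also have "\<dots> \<le> B" by (rule g(3))
  finally have gj: "g j \<le> B * inverse (real (Suc j))" by (simp add: field_simps)
  have "norm (of_real (g j) * w) \<le> (B * inverse (real (Suc j))) * 1"
    unfolding norm_mult using g(2)[of j] gj w by (intro mult_mono) auto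
  then have "(norm (of_real (g j) * w))\<^sup>2 \<le> (B * inverse (real (Suc j)))\<^sup>2"
    by (intro power_mono) auto
  with norm_ln_remainder_le[OF 1] 
  show "norm (ln_remainder (of_real (g j) * w)) \<le> 2 * B\<^sup>2 * inverse (real (Suc j) ^ 2)"
    by (simp add: power_mult_distrib power_inverse)
qed

lemma summable_inverse_square_Suc: "summable (\<lambda>j. c * inverse (real (Suc j) ^ 2))"
  using inverse_power_summable[of 2, where ?'a = real]
  by (intro summable_mult) (subst summable_Suc_iff[of "\<lambda>n. inverse (real n ^ 2)"], simp)

lemma isCont_ln_remainder: "norm u < 1 \<Longrightarrow> isCont ln_remainder u"
  unfolding ln_remainder_def[abs_def] using one_plus_notin_nonpos_Reals[of u]
  by (intro continuous_intros) auto

text \<open>The radius 1/2 is that of the quadratic remainder bound: entries in [0, 1] keep all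
  products g w in that disc. The derivatives at 1 enter because their quotients by the values there
  are the sums of the g's.\<close>

lemma nonpos_rooted_limit_near_1:
  fixes P :: "nat \<Rightarrow> complex poly"
  assumes P: "\<And>n. nonpos_rooted (P n)" and lim: "\<And>z. (\<lambda>n. poly (P n) z) \<longlonglongrightarrow> h z"
    and lim': "(\<lambda>n. poly (pderiv (P n)) 1) \<longlonglongrightarrow> d" and h1: "h 1 \<noteq> 0"
  shows "\<exists>\<alpha> \<gamma>. \<alpha> \<ge> 0 \<and> decseq \<gamma> \<and> (\<forall>j. \<gamma> j \<in> {0..1}) \<and> summable \<gamma> \<and>
    (\<forall>w. norm w \<le> 1 / 2 \<longrightarrow> h (1 + w) = h 1 * exp (of_real \<alpha> * w) * (\<Prod>j. 1 + of_real (\<gamma> j) * w))"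
proof -
  from nonpos_rooted_sorted_factorization[OF P]
  obtain g :: "nat \<Rightarrow> nat \<Rightarrow> real" and N where g: "\<And>n. decseq (g n)" "\<And>n j. g n j \<in> {0..1}" "\<And>n j. j \<ge> N n \<Longrightarrow> g n j = 0"
    and fac: "\<And>n w. poly (P n) (1 + w) = poly (P n) 1 * (\<Prod>j<N n. 1 + of_real (g n j) * w)"
    and der: "\<And>n. poly (pderiv (P n)) 1 = poly (P n) 1 * of_real (\<Sum>j<N n. g n j)"
    by metis
  define S where "S = (\<lambda>n. \<Sum>j<N n. g n j)"
  \<comment> \<open>The limit of the logarithmic derivatives at 1, which are the real sums
    \<open>S n\<close>.\<close>
  define s where "s = Re (d / h 1)"
  have P1: "poly (P n) 1 \<noteq> 0" for n
    using P[of n] by (auto simp: nonpos_rooted_def)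
  have "(\<lambda>n. Re (poly (pderiv (P n)) 1 / poly (P n) 1)) \<longlonglongrightarrow> s"
    unfolding s_def by (intro tendsto_Re tendsto_divide lim lim' h1)
  then have S: "S \<longlonglongrightarrow> s"
    unfolding der S_def using P1 by (simp del: of_real_sum)
  then obtain B where B: "\<And>n. S n \<le> B"
    using convergent_imp_Bseq[of S] convergentI[of S] by (auto simp: Bseq_def dest: abs_le_D1)
  have gS: "(\<Sum>j<K. g n j) \<le> S n" for n K
  proof -
    have "(\<Sum>j<K. g n j) \<le> (\<Sum>j\<in>{..<K} \<union> {..<N n}. g n j)"
      using g(2)[of n] by (intro sum_mono2) auto
    also have "\<dots> = S n"
      unfolding S_def by (intro sum.mono_neutral_right) (auto simp: g(3))
    finally show ?thesis .
  qed
  have gB: "(\<Sum>j<K. g n j) \<le> B" for n K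
    using gS B order_trans by blast
  have "norm (g n x) \<le> 1" for n x
    using g(2)[of n x] by simp
  then obtain k where k: "strict_mono (k :: nat \<Rightarrow> nat)" "\<And>x. \<exists>l. (\<lambda>n. g (k n) x) \<longlonglongrightarrow> l"
    using function_convergent_subsequence[of "UNIV :: nat set" g 1] by (metis UNIV_I countableI_type)
  then obtain \<gamma> where \<gamma>: "\<And>j. (\<lambda>n. g (k n) j) \<longlonglongrightarrow> \<gamma> j" by metis
  have Sk: "(\<lambda>n. S (k n)) \<longlonglongrightarrow> s"
    using LIMSEQ_subseq_LIMSEQ[OF S k(1)] by (simp add: o_def)
  have \<gamma>01: "\<gamma> j \<in> {0..1}" for j
  proof -
    have "0 \<le> \<gamma> j" by (rule LIMSEQ_le_const[OF \<gamma>]) (use g(2) in auto)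
    moreover have "\<gamma> j \<le> 1" by (rule LIMSEQ_le_const2[OF \<gamma>]) (use g(2) in auto)
    ultimately show ?thesis by simp
  qed
  have dec: "decseq \<gamma>"
    by (rule decseq_SucI, rule LIMSEQ_le[OF \<gamma> \<gamma>]) (use g(1) decseq_SucD in blast)
  have part: "(\<Sum>j<K. \<gamma> j) \<le> s" for K
    by (rule LIMSEQ_le[OF tendsto_sum Sk, of _ "\<lambda>j n. g (k n) j"]) (use \<gamma> gS in auto)
  have sum\<gamma>: "summable \<gamma>"
    by (rule bounded_imp_summable[where B=s])
       (use \<gamma>01 part in \<open>auto simp del: sum.lessThan_Suc simp flip: lessThan_Suc_atMost\<close>)
  have le_s: "suminf \<gamma> \<le> s"
    by (rule suminf_le_const[OF sum\<gamma> part])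
  show ?thesis
  \<comment> \<open>In the limit the first-order terms give exp (s w), but the product over \<gamma>
    accounts only for \<open>suminf \<gamma>\<close> of s. The difference is nonnegative because the
    partial sums of \<gamma> are limits of partial sums bounded by \<open>S\<close>.\<close>
  proof (intro exI[of _ "s - suminf \<gamma>"] exI[of _ \<gamma>] conjI allI impI dec \<gamma>01 sum\<gamma>)
    show "s - suminf \<gamma> \<ge> 0" using le_s by simp
    fix w :: complex assume w: "norm w \<le> 1 / 2"
    let ?T = "\<lambda>\<gamma>. \<Sum>j. ln_remainder (of_real (\<gamma> j) * w)"
    note domg = ln_remainder_dominated[OF g(1) g(2) gB w]
    have sB: "(\<Sum>j<K. \<gamma> j) \<le> B" for K
      by (rule LIMSEQ_le_const2[OF tendsto_sum, of _ "\<lambda>j n. g (k n) j"]) (use \<gamma> gB in auto)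
    note dom\<gamma> = ln_remainder_dominated[OF dec \<gamma>01 sB w]
    have T: "(\<lambda>n. ?T (g (k n))) \<longlonglongrightarrow> ?T \<gamma>"
    proof (rule tannery_sequentially(2)[OF _ domg(2) summable_inverse_square_Suc])
      show "(\<lambda>n. ln_remainder (of_real (g (k n) j) * w)) \<longlonglongrightarrow> ln_remainder (of_real (\<gamma> j) * w)" for j
      proof (rule isCont_tendsto_compose[OF isCont_ln_remainder])
        show "norm (of_real (\<gamma> j) * w) < 1" using dom\<gamma>(1)[of j] by linarith
      qed (intro tendsto_intros \<gamma>)
    qed
    have "poly (P n) (1 + w) = poly (P n) 1 * (exp (of_real (S n) * w) * exp (?T (g n)))" for n
    proof -
      \<comment> \<open>As \<open>ln_remainder 0 = 0\<close>, the padding is invisible; a series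
        over all j replaces sums of varying length, and Tannery's theorem applies.\<close>
      have "?T (g n) = (\<Sum>j<N n. ln_remainder (of_real (g n j) * w))"
        by (rule suminf_finite) (auto simp: g(3) ln_remainder_def)
      then show ?thesis
        unfolding fac prod_linear_eq_exp[OF domg(1)] by (simp add: S_def sum_distrib_right)
    qed
    moreover have "(\<lambda>n. poly (P (k n)) 1 * (exp (of_real (S (k n)) * w) * exp (?T (g (k n)))))
        \<longlonglongrightarrow> h 1 * (exp (of_real s * w) * exp (?T \<gamma>))"
      by (intro tendsto_intros T Sk LIMSEQ_subseq_LIMSEQ[OF lim k(1), unfolded o_def])
    moreover have "(\<lambda>n. poly (P (k n)) (1 + w)) \<longlonglongrightarrow> h (1 + w)"
      by (intro LIMSEQ_subseq_LIMSEQ[OF lim k(1), unfolded o_def])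
    ultimately have 1: "h (1 + w) = h 1 * (exp (of_real s * w) * exp (?T \<gamma>))"
      using LIMSEQ_unique by auto
    have "(\<lambda>K. \<Prod>j<K. 1 + of_real (\<gamma> j) * w) \<longlonglongrightarrow> exp (of_real (suminf \<gamma>) * w) * exp (?T \<gamma>)"
      unfolding prod_linear_eq_exp[OF dom\<gamma>(1)]
    proof (intro tendsto_intros)
      show "(\<lambda>K. \<Sum>j<K. of_real (\<gamma> j) * w) \<longlonglongrightarrow> of_real (suminf \<gamma>) * w"
        unfolding sum_distrib_right[symmetric] of_real_sum[symmetric]
        by (intro tendsto_intros summable_LIMSEQ sum\<gamma>)
      show "(\<lambda>K. \<Sum>j<K. ln_remainder (of_real (\<gamma> j) * w)) \<longlonglongrightarrow> ?T \<gamma>"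
        by (intro summable_LIMSEQ summable_comparison_test[OF _ summable_inverse_square_Suc])
           (use dom\<gamma>(2) in blast)
    qed
    moreover have "(\<lambda>K. \<Prod>j<K. 1 + of_real (\<gamma> j) * w) \<longlonglongrightarrow> (\<Prod>j. 1 + of_real (\<gamma> j) * w)"
      using \<gamma>01 by (intro has_prod_imp_tendsto' convergent_prod_has_prod convergent_prod_linear sum\<gamma>) auto
    ultimately have 2: "(\<Prod>j. 1 + of_real (\<gamma> j) * w) = exp (of_real (suminf \<gamma>) * w) * exp (?T \<gamma>)"
      using LIMSEQ_unique by blast
    have "exp (of_real s * w) = exp (of_real (s - suminf \<gamma>) * w) * exp (of_real (suminf \<gamma>) * w)"
      by (simp add: exp_add[symmetric] algebra_simps)
    then show "h (1 + w) = h 1 * exp (of_real (s - suminf \<gamma>) * w) * (\<Prod>j. 1 + of_real (\<gamma> j) * w)"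
      unfolding 1 2 by simp
  qed
qed

text \<open>The coefficient limits for m = 0 form an everywhere convergent power series of the
  product. Holomorphy is what the continuation from the small disc requires.\<close>

lemma Laguerre_product_holomorphic:
  assumes "\<alpha> \<ge> 0" "\<And>j. \<gamma> j \<ge> 0" "summable \<gamma>"
  shows "(\<lambda>w :: complex. exp (of_real \<alpha> * w) * (\<Prod>j. 1 + of_real (\<gamma> j) * w)) holomorphic_on UNIV"
proof -
  obtain e where "\<And>z :: complex. (\<lambda>k. e k * z ^ k) sums (z ^ 0 * exp (of_real \<alpha> * z) * (\<Prod>j. 1 + of_real (\<gamma> j) * z))"
    by (rule Laguerre_product_approx[OF assms, where m = 0]) (rule that)
  then have e: "(\<lambda>k. e k * z ^ k) sums (exp (of_real \<alpha> * z) * (\<Prod>j. 1 + of_real (\<gamma> j) * z))"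
    for z :: complex
    by simp
  have "(\<lambda>w. \<Sum>k. e k * w ^ k) holomorphic_on UNIV"
    using termdiffs_strong_converges_everywhere[of e] sums_summable[OF e]
    by (auto simp: holomorphic_on_open)
  then show ?thesis using e by (simp add: sums_iff)
qed

text \<open>The factors with \<open>\<gamma>\<^sub>j = 1\<close> produce the power of \<open>z\<close>; the others are rescaled by \<open>1 - \<gamma>\<^sub>j\<close>.\<close>

lemma Laguerre_recenter:
  assumes h: "h holomorphic_on UNIV" and \<alpha>: "\<alpha> \<ge> 0" and \<gamma>: "decseq \<gamma>" "\<And>j. \<gamma> j \<in> {0..1}" "summable \<gamma>"
    and eq: "\<And>w. h (1 + w) = C * exp (of_real \<alpha> * w) * (\<Prod>j. 1 + of_real (\<gamma> j) * w)"
  shows "h \<in> Laguerre"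
proof -
  have "\<gamma> \<longlonglongrightarrow> 0" using \<gamma>(3) by (rule summable_LIMSEQ_zero)
  then have ex: "\<exists>j. \<gamma> j < 1"
    using order_tendstoD(2)[of \<gamma> 0 sequentially 1] eventually_happens'[of sequentially] by auto
  \<comment> \<open>The entries equal to 1 come first in the decreasing sequence and are finite in
    number, as it tends to 0; \<open>m\<close> counts them.\<close>
  define m where "m = (LEAST j. \<gamma> j < 1)"
  have m: "\<gamma> m < 1" unfolding m_def using ex by (rule LeastI_ex)
  have less_m: "\<gamma> j = 1" if "j < m" for j
    using not_less_Least[of j "\<lambda>j. \<gamma> j < 1"] that \<gamma>(2)[of j] by (auto simp: m_def)
  \<comment> \<open>Chosen so that 1 + \<gamma> (z - 1) = (1 - \<gamma>) (1 + \<beta> z). The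
    constants 1 - \<gamma> form a convergent product that is absorbed into the leading
    constant.\<close>
  define \<beta> where "\<beta> = (\<lambda>i. \<gamma> (i + m) / (1 - \<gamma> (i + m)))"
  have lt: "\<gamma> (i + m) \<le> \<gamma> m" "\<gamma> (i + m) < 1" for i
    using decseqD[OF \<gamma>(1), of m "i + m"] m by auto
  have \<beta>0: "\<beta> i \<ge> 0" for i
    using lt[of i] \<gamma>(2)[of "i + m"] by (simp add: \<beta>_def)
  have \<beta>dec: "\<beta> (Suc i) \<le> \<beta> i" for i
    unfolding \<beta>_def using lt[of i] lt[of "Suc i"] \<gamma>(2)[of "Suc i + m"] decseqD[OF \<gamma>(1), of "i + m" "Suc i + m"]
    by (intro frac_le) auto
  have \<gamma>m: "summable (\<lambda>i. \<gamma> (i + m))" using \<gamma>(3) by (simp add: summable_iff_shift)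
  have \<beta>sum: "summable \<beta>"
  proof (rule summable_comparison_test[OF _ summable_mult2[OF \<gamma>m, of "1 / (1 - \<gamma> m)"]], intro exI allI impI)
    fix i
    show "norm (\<beta> i) \<le> \<gamma> (i + m) * (1 / (1 - \<gamma> m))"
      unfolding \<beta>_def using lt[of i] m \<gamma>(2)[of "i + m"] by (auto intro!: divide_left_mono)
  qed
  have main: "h z = (C * exp (- of_real \<alpha>) * (\<Prod>i. 1 + of_real (\<gamma> (i + m)) * (-1))) * z ^ m
      * exp (of_real \<alpha> * z) * (\<Prod>j. 1 + of_real (\<beta> j) * z)" for z
  proof -
    let ?f = "\<lambda>j. 1 + of_real (\<gamma> j) * (z - 1)"
    have "convergent_prod ?f" using \<gamma> by (intro convergent_prod_linear) auto
    then have "?f has_prod ((\<Prod>j<m. ?f j) * (\<Prod>j. ?f (j + m)))"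
      by (rule has_prod_ignore_initial_segment')
    then have "(\<Prod>j. ?f j) = (\<Prod>j<m. ?f j) * (\<Prod>j. ?f (j + m))"
      by (rule has_prod_unique[symmetric])
    also have "(\<Prod>j<m. ?f j) = (\<Prod>j<m. z)"
      by (intro prod.cong) (auto simp: less_m)
    also have "(\<Prod>j. ?f (j + m)) = (\<Prod>i. (1 + of_real (\<gamma> (i + m)) * (-1)) * (1 + of_real (\<beta> i) * z))"
    proof (intro arg_cong[where f = prodinf] ext)
      fix i
      have "of_real (1 - \<gamma> (i + m)) * of_real (\<beta> i) = (of_real (\<gamma> (i + m)) :: complex)"
        using lt[of i] by (simp add: \<beta>_def flip: of_real_mult)
      then have "(1 + of_real (\<gamma> (i + m)) * (-1)) * (of_real (\<beta> i) * z) = of_real (\<gamma> (i + m)) * z"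
        by (simp flip: mult.assoc)
      then show "?f (i + m) = (1 + of_real (\<gamma> (i + m)) * (-1)) * (1 + of_real (\<beta> i) * z)"
        by (simp add: ring_distribs)
    qed
    also have "\<dots> = (\<Prod>i. 1 + of_real (\<gamma> (i + m)) * (-1)) * (\<Prod>i. 1 + of_real (\<beta> i) * z)"
      using \<gamma> \<gamma>m \<beta>sum \<beta>0 by (intro prodinf_mult[symmetric] convergent_prod_linear) auto
    finally have "(\<Prod>j. ?f j) = z ^ m * ((\<Prod>i. 1 + of_real (\<gamma> (i + m)) * (-1)) * (\<Prod>i. 1 + of_real (\<beta> i) * z))"
      by simp
    moreover have "exp (of_real \<alpha> * (z - 1)) = exp (- of_real \<alpha>) * exp (of_real \<alpha> * z)"
      by (simp add: exp_add[symmetric] algebra_simps)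
    ultimately show ?thesis
      using eq[of "z - 1"] by simp
  qed
  show ?thesis
    unfolding Laguerre_def using h \<alpha> \<beta>dec \<beta>0 \<beta>sum main by blast
qed

lemma pderiv_cseq: "cseq (pderiv p) l = cseq p (Suc l)"
  by (simp add: cseq_def coeff_pderiv)

lemma poly_tendsto_egf:
  assumes "\<And>n l. norm (cseq (P n) l) \<le> K * r ^ l" "\<And>l. (\<lambda>n. cseq (P n) l) \<longlonglongrightarrow> x l"
  shows "(\<lambda>n. poly (P n) z) \<longlonglongrightarrow> egf x z"
  unfolding egf_cseq[symmetric] unfolding egf_def
proof (rule tannery_sequentially(2)[OF _ _ summable_geom_exp])
  show "(\<lambda>n. cseq (P n) l / fact l * z ^ l) \<longlonglongrightarrow> x l / fact l * z ^ l" for l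
    by (intro tendsto_intros assms(2)) auto
  show "norm (cseq (P n) l / fact l * z ^ l) \<le> K * r ^ l * norm z ^ l / fact l" for n l
    using assms(1)[of n l] by (simp add: norm_mult norm_divide norm_power mult_right_mono divide_right_mono)
qed

lemma nonpos_rooted_limit_Laguerre:
  assumes P: "\<And>n. P n = 0 \<or> nonpos_rooted (P n)" and r: "r \<ge> 0"
    and bound: "\<And>n l. norm (cseq (P n) l) \<le> K * r ^ l" and lim: "\<And>l. (\<lambda>n. cseq (P n) l) \<longlonglongrightarrow> x l"
  shows "egf x \<in> Laguerre"
proof (cases "\<forall>l. x l = 0")
  case True
  then have "egf x = (\<lambda>z. 0)" by (simp add: egf_def fun_eq_iff)
  then show ?thesis
    unfolding Laguerre_def by (auto intro!: exI[of _ 0] exI[of _ "\<lambda>_. 0"])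
next
  case False
  then obtain l where l: "x l \<noteq> 0" by blast
  have K: "K \<ge> 0" using order_trans[OF norm_ge_zero bound[of _ 0]] by simp
  have xb: "norm (x l) \<le> K * r ^ l" for l
    by (rule LIMSEQ_le_const2[OF tendsto_norm[OF lim]]) (use bound in auto)
  then have gx: "geom_bounded x" using K r by (auto simp: geom_bounded_def)
  have lim1: "(\<lambda>n. poly (P n) z) \<longlonglongrightarrow> egf x z" for z
    by (rule poly_tendsto_egf[OF bound lim])
  have lim2: "(\<lambda>n. poly (pderiv (P n)) 1) \<longlonglongrightarrow> egf (\<lambda>l. x (Suc l)) 1"
  proof (rule poly_tendsto_egf)
    show "norm (cseq (pderiv (P n)) l) \<le> (K * r) * r ^ l" for n l
      using bound[of n "Suc l"] by (simp add: pderiv_cseq mult.assoc)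
    show "(\<lambda>n. cseq (pderiv (P n)) l) \<longlonglongrightarrow> x (Suc l)" for l
      unfolding pderiv_cseq by (rule lim)
  qed
  have "norm (x l) / fact l \<le> norm (egf x 1)"
  proof (rule LIMSEQ_le[OF tendsto_divide[OF tendsto_norm[OF lim] tendsto_const] tendsto_norm[OF lim1]])
    have "norm (cseq (P n) l) / fact l \<le> norm (poly (P n) 1)" for n
      using P[of n] norm_coeff_le_norm_poly_1[of "P n" l] by (auto simp: cseq_def norm_mult)
    then show "\<exists>N. \<forall>n\<ge>N. norm (cseq (P n) l) / fact l \<le> norm (poly (P n) 1)" by blast
  qed simp
  moreover have "0 < norm (x l) / fact l" using l by simp
  ultimately have h1: "egf x 1 \<noteq> 0" by (metis norm_zero not_less)
  then have "eventually (\<lambda>n. poly (P n) 1 \<noteq> 0) sequentially"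
    by (rule tendsto_imp_eventually_ne[OF lim1])
  \<comment> \<open>Some early approximants may be the zero polynomial; shifting by
    \<open>n0\<close> leaves only those with a factorization.\<close>
  then obtain n0 where "\<And>n. n \<ge> n0 \<Longrightarrow> poly (P n) 1 \<noteq> 0"
    by (auto simp: eventually_sequentially)
  then have "poly (P (n + n0)) 1 \<noteq> 0" for n by simp
  then have P': "nonpos_rooted (P (n + n0))" for n using P[of "n + n0"] by (metis poly_0)
  have "\<exists>\<alpha> \<gamma>. \<alpha> \<ge> 0 \<and> decseq \<gamma> \<and> (\<forall>j. \<gamma> j \<in> {0..1}) \<and> summable \<gamma> \<and>
    (\<forall>w. norm w \<le> 1 / 2 \<longrightarrow> egf x (1 + w) = egf x 1 * exp (of_real \<alpha> * w) * (\<Prod>j. 1 + of_real (\<gamma> j) * w))"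
    by (rule nonpos_rooted_limit_near_1[OF P' LIMSEQ_ignore_initial_segment[OF lim1]
          LIMSEQ_ignore_initial_segment[OF lim2] h1])
  then obtain \<alpha> \<gamma> where ag: "\<alpha> \<ge> 0" "decseq \<gamma>" "\<And>j. \<gamma> j \<in> {0..1}" "summable \<gamma>"
    and eq: "\<And>w. norm w \<le> 1 / 2 \<Longrightarrow> egf x (1 + w) = egf x 1 * exp (of_real \<alpha> * w) * (\<Prod>j. 1 + of_real (\<gamma> j) * w)"
    by blast
  have hol: "(\<lambda>w. egf x (1 + w)) holomorphic_on UNIV"
    by (rule holomorphic_on_compose[of "\<lambda>w. 1 + w" UNIV "egf x", unfolded o_def])
       (auto intro: holomorphic_intros holomorphic_on_subset[OF holomorphic_egf[OF gx]])
  have hol': "(\<lambda>w. egf x 1 * (exp (of_real \<alpha> * w) * (\<Prod>j. 1 + of_real (\<gamma> j) * w))) holomorphic_on UNIV"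
    using ag by (intro holomorphic_intros Laguerre_product_holomorphic) auto
  have "egf x (1 + w) = egf x 1 * (exp (of_real \<alpha> * w) * (\<Prod>j. 1 + of_real (\<gamma> j) * w))" for w
    by (rule analytic_continuation_open[where s = "ball 0 (1/2)", OF _ _ _ _ _ hol hol'])
       (use eq in auto)
  then show ?thesis
    by (intro Laguerre_recenter[OF holomorphic_egf[OF gx] ag, where C = "egf x 1"]) (simp add: mult.assoc)
qed


section \<open>The topology of \<open>\<A>\<^sub>a\<close>\<close>

lemma geom_bounded_diff:
  "geom_bounded g \<Longrightarrow> geom_bounded h \<Longrightarrow> geom_bounded (\<lambda>l. g l - h l)"
  using geom_bounded_add_cmult[of g h 1 "-1"] by simp

lemma egf_diff:
  "geom_bounded g \<Longrightarrow> geom_bounded h \<Longrightarrow> egf g z - egf h z = egf (\<lambda>l. g l - h l) z"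
  using sums_diff[OF egf_sums egf_sums, of g h z z]
  by (simp add: egf_def sums_iff diff_divide_distrib ring_distribs)

lemma Aspace_egf_kderiv: "f \<in> Aspace a \<Longrightarrow> egf (\<lambda>k. kderiv k f 0) = f"
  by (simp add: Aspace_def egf_kderiv)

lemma Aspace_diff_egf:
  assumes "f \<in> Aspace a" "g \<in> Aspace a"
  shows "(\<lambda>z. f z - g z) = egf (\<lambda>k. kderiv k f 0 - kderiv k g 0)"
  using egf_diff[OF assms[THEN Aspace_geom_bounded]] assms[THEN Aspace_egf_kderiv]
  by (simp add: fun_eq_iff)

lemma kderiv_diff:
  assumes "f \<in> Aspace a" "g \<in> Aspace a"
  shows "kderiv k (\<lambda>z. f z - g z) 0 = kderiv k f 0 - kderiv k g 0"
  unfolding Aspace_diff_egf[OF assms]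
  using kderiv_egf_0[OF geom_bounded_diff[OF assms[THEN Aspace_geom_bounded]]] by simp

lemma Aspace_diff:
  assumes "a \<ge> 0" and fg: "f \<in> Aspace a" "g \<in> Aspace a"
  shows "(\<lambda>z. f z - g z) \<in> Aspace a"
  unfolding Aspace_diff_egf[OF fg]
proof (rule egf_in_Aspace[OF assms(1)])
  fix r assume r: "r > a"
  have "norm (kderiv l f 0 - kderiv l g 0) \<le> (normb r f + normb r g) * r ^ l" for l
    using norm_triangle_ineq4[of "kderiv l f 0" "kderiv l g 0"]
      Aspace_normb_bound[OF fg(1) r, of l] Aspace_normb_bound[OF fg(2) r, of l] r assms(1)
    by (simp add: ring_distribs)
  then show "\<exists>M. \<forall>l. norm (kderiv l f 0 - kderiv l g 0) \<le> M * r ^ l" by blast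
qed

lemma normb_triangle:
  assumes "a \<ge> 0" and fgh: "f \<in> Aspace a" "g \<in> Aspace a" "h \<in> Aspace a" and r: "r > a"
  shows "normb r (\<lambda>z. f z - h z) \<le> normb r (\<lambda>z. f z - g z) + normb r (\<lambda>z. g z - h z)"
proof (rule normb_le)
  fix k
  have r0: "r > 0" using assms by simp
  have "norm (kderiv k (\<lambda>z. f z - h z) 0)
      \<le> norm (kderiv k (\<lambda>z. f z - g z) 0) + norm (kderiv k (\<lambda>z. g z - h z) 0)"
    using norm_triangle_ineq[of "kderiv k f 0 - kderiv k g 0" "kderiv k g 0 - kderiv k h 0"]
    by (simp add: kderiv_diff[where a = a] fgh)
  also have "\<dots> \<le> normb r (\<lambda>z. f z - g z) * r ^ k + normb r (\<lambda>z. g z - h z) * r ^ k"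
    using assms r0 by (intro add_mono Aspace_normb_bound[where a = a] Aspace_diff) auto
  finally show "norm (kderiv k (\<lambda>z. f z - h z) 0)
      \<le> (normb r (\<lambda>z. f z - g z) + normb r (\<lambda>z. g z - h z)) * r ^ k"
    by (simp add: ring_distribs)
qed (use assms in simp)

lemma normb_0: "r > 0 \<Longrightarrow> normb r (\<lambda>z. f z - f z) \<le> 0"
proof (rule normb_le)
  fix k
  have "egf (\<lambda>_. 0) = (\<lambda>z. 0)"
    by (simp add: egf_def fun_eq_iff)
  moreover have "geom_bounded (\<lambda>_. 0)"
    by (auto simp: geom_bounded_def intro!: exI[of _ 0])
  ultimately have "kderiv k (\<lambda>z. 0) 0 = 0"
    using kderiv_egf_0[of "\<lambda>_. 0" k] by simp
  then show "norm (kderiv k (\<lambda>z. f z - f z) 0) \<le> 0 * r ^ k" by simp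
qed

text \<open>\<open>Atop\<close> can be unfolded only once its family of sets is shown to be a
  topology; for intersections one unites the finite index sets and takes the smaller radius.\<close>

lemma openin_Atop:
  "openin (Atop a) U \<longleftrightarrow> U \<subseteq> Aspace a \<and>
      (\<forall>f\<in>U. \<exists>B e. finite B \<and> B \<subseteq> {a<..} \<and> e > 0 \<and>
          {g \<in> Aspace a. \<forall>b\<in>B. normb b (\<lambda>z. g z - f z) < e} \<subseteq> U)"
proof -
  define N where "N = (\<lambda>f B e. {g \<in> Aspace a. \<forall>b\<in>B. normb b (\<lambda>z. g z - f z) < e})"
  define nbhd where "nbhd = (\<lambda>f U. \<exists>B e. finite B \<and> B \<subseteq> {a<..} \<and> e > 0 \<and> N f B e \<subseteq> U)"
  have mono: "nbhd f V" if "nbhd f U" "U \<subseteq> V" for f U V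
    using that unfolding nbhd_def by (meson order_trans)
  have inter: "nbhd f (S \<inter> T)" if S: "nbhd f S" and T: "nbhd f T" for f S T
  proof -
    obtain B e where 1: "finite B" "B \<subseteq> {a<..}" "e > 0" "N f B e \<subseteq> S"
      using S unfolding nbhd_def by blast
    obtain B' e' where 2: "finite B'" "B' \<subseteq> {a<..}" "e' > 0" "N f B' e' \<subseteq> T"
      using T unfolding nbhd_def by blast
    have "N f (B \<union> B') (min e e') \<subseteq> N f B e \<inter> N f B' e'" by (auto simp: N_def)
    then have "N f (B \<union> B') (min e e') \<subseteq> S \<inter> T" using 1(4) 2(4) by blast
    moreover have "finite (B \<union> B')" "B \<union> B' \<subseteq> {a<..}" "min e e' > 0" using 1 2 by auto
    ultimately show ?thesis unfolding nbhd_def by blast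
  qed
  have "istopology (\<lambda>U. U \<subseteq> Aspace a \<and> (\<forall>f\<in>U. nbhd f U))"
    unfolding istopology_def
  proof (intro conjI allI impI ballI)
    show "nbhd f (\<Union>K)" if "\<forall>U\<in>K. U \<subseteq> Aspace a \<and> (\<forall>f\<in>U. nbhd f U)" "f \<in> \<Union>K" for f K
      using that mono by (meson Union_upper UnionE)
  qed (use inter in auto)
  then show ?thesis
    by (simp add: Atop_def nbhd_def N_def)
qed

lemma topspace_Atop: "topspace (Atop a) = Aspace a"
proof -
  have "openin (Atop a) (Aspace a)"
    unfolding openin_Atop by (auto intro!: exI[of _ "{}"] exI[of _ "1 :: real"])
  then show ?thesis
    by (metis openin_Atop openin_subset openin_topspace subset_antisym)
qed

lemma topspace_LaguerreA_top: "topspace (LaguerreA_top a) = LaguerreA a"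
  by (auto simp: LaguerreA_top_def topspace_Atop LaguerreA_def)

lemma openin_Atop_ball:
  assumes a: "a \<ge> 0" and f: "f \<in> Aspace a" and r: "r > a"
  shows "openin (Atop a) {g \<in> Aspace a. normb r (\<lambda>z. g z - f z) < e}"
  unfolding openin_Atop
proof (intro conjI ballI)
  fix g assume "g \<in> {g \<in> Aspace a. normb r (\<lambda>z. g z - f z) < e}"
  then have g: "g \<in> Aspace a" "normb r (\<lambda>z. g z - f z) < e" by auto
  have "normb r (\<lambda>z. h z - f z) < e"
    if "h \<in> Aspace a" "normb r (\<lambda>z. h z - g z) < e - normb r (\<lambda>z. g z - f z)" for h
    using normb_triangle[OF a that(1) g(1) f r] that(2) by linarith
  then show "\<exists>B d. finite B \<and> B \<subseteq> {a<..} \<and> d > 0 \<and>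
      {h \<in> Aspace a. \<forall>b\<in>B. normb b (\<lambda>z. h z - g z) < d} \<subseteq> {g \<in> Aspace a. normb r (\<lambda>z. g z - f z) < e}"
    using g r by (intro exI[of _ "{r}"] exI[of _ "e - normb r (\<lambda>z. g z - f z)"]) auto
qed auto

section \<open>Continuity\<close>

lemma op_bounds_Aspace:
  assumes "\<theta> \<ge> 0" "\<omega> \<ge> 0" "a \<ge> 0" "b \<ge> 0" "a' > a" "b' > b" "b' * Eexp \<omega> a' < 1"
    and "\<phi> \<in> Aspace a" "f \<in> Aspace b"
  shows "op_bounds \<theta> \<omega> a' b' (normb a' \<phi>) (normb b' f) (\<lambda>k. kderiv k \<phi> 0) (\<lambda>k. kderiv k f 0)"
  using assms by unfold_locales (auto intro: Aspace_normb_bound)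

text \<open>Bilinear telescoping through the mixed pair x', g. The bounds \<open>M'\<close> and
  \<open>N\<close> make its series converge as well, which is the purpose of the third
  interpretation.\<close>

lemma opcoef_diff:
  assumes "op_bounds \<theta> \<omega> a b M N x g" "op_bounds \<theta> \<omega> a b M' N' x' g'"
  shows "opcoef \<theta> \<omega> x g l - opcoef \<theta> \<omega> x' g' l
    = opcoef \<theta> \<omega> (\<lambda>k. x k - x' k) g l + opcoef \<theta> \<omega> x' (\<lambda>k. g k - g' k) l"
proof -
  interpret I1: op_bounds \<theta> \<omega> a b M N x g by fact
  interpret I2: op_bounds \<theta> \<omega> a b M' N' x' g' by fact
  interpret I3: op_bounds \<theta> \<omega> a b M' N x' g
    using I1.nonneg I1.lt1 I2.x_le I1.g_le by unfold_locales
  let ?S = "\<lambda>x g k. x k / fact k * (opT \<theta> \<omega> ^^ k) g l"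
  have T: "(opT \<theta> \<omega> ^^ k) (\<lambda>k. g k - g' k) l = (opT \<theta> \<omega> ^^ k) g l - (opT \<theta> \<omega> ^^ k) g' l" for k
    using opT_funpow_lincomb[of k \<theta> \<omega> 1 g "-1" g' l] by simp
  have s: "?S x g sums opcoef \<theta> \<omega> x g l" "?S x' g' sums opcoef \<theta> \<omega> x' g' l" "?S x' g sums opcoef \<theta> \<omega> x' g l"
    unfolding opcoef_def by (intro summable_sums I1.opcoef_summable I2.opcoef_summable I3.opcoef_summable)+
  have "?S (\<lambda>k. x k - x' k) g sums (opcoef \<theta> \<omega> x g l - opcoef \<theta> \<omega> x' g l)"
    using sums_diff[OF s(1,3)] by (simp add: diff_divide_distrib left_diff_distrib)
  moreover have "?S x' (\<lambda>k. g k - g' k) sums (opcoef \<theta> \<omega> x' g l - opcoef \<theta> \<omega> x' g' l)"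
    using sums_diff[OF s(3,2)] by (simp add: T right_diff_distrib)
  ultimately have "opcoef \<theta> \<omega> (\<lambda>k. x k - x' k) g l = opcoef \<theta> \<omega> x g l - opcoef \<theta> \<omega> x' g l"
    "opcoef \<theta> \<omega> x' (\<lambda>k. g k - g' k) l = opcoef \<theta> \<omega> x' g l - opcoef \<theta> \<omega> x' g' l"
    unfolding opcoef_def[of _ _ "\<lambda>k. x k - x' k"] opcoef_def[of _ _ x' "\<lambda>k. g k - g' k"]
    by (simp_all only: sums_iff)
  then show ?thesis by simp
qed

context
  fixes \<theta> \<omega> a b :: real
  assumes params: "\<theta> \<ge> 0" "\<omega> \<ge> 0" "a \<ge> 0" "b \<ge> 0" and small: "b * Eexp \<omega> a < 1"
begin

lemma phiDelta_Aspace: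
  assumes "\<phi> \<in> Aspace a" "f \<in> Aspace b"
  shows "phiDelta_term \<theta> \<omega> \<phi> f z sums phiDelta \<theta> \<omega> \<phi> f z"
    and "phiDelta \<theta> \<omega> \<phi> f = egf (opcoef \<theta> \<omega> (\<lambda>k. kderiv k \<phi> 0) (\<lambda>k. kderiv k f 0))"
    and "phiDelta \<theta> \<omega> \<phi> f \<in> Aspace (flow_rate \<omega> b a)"
proof -
  let ?x = "\<lambda>k. kderiv k \<phi> 0" and ?g = "\<lambda>k. kderiv k f 0"
  have ob: "\<exists>a' b'. op_bounds \<theta> \<omega> a' b' (normb a' \<phi>) (normb b' f) ?x ?g
      \<and> flow_rate \<omega> b' a' \<le> r" if "r > flow_rate \<omega> b a" for r
  proof -
    obtain a' b' where "a' > a" "b' > b" "b' * Eexp \<omega> a' < 1" "flow_rate \<omega> b' a' \<le> r"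
      using flow_rate_approx[OF small \<open>r > flow_rate \<omega> b a\<close>] .
    with op_bounds_Aspace[OF params _ _ _ assms] show ?thesis by blast
  qed
  \<comment> \<open>Convergence and the closed form require a single admissible pair, so any r above
    the rate serves; membership in the space takes a new pair for each r.\<close>
  obtain a' b' where "op_bounds \<theta> \<omega> a' b' (normb a' \<phi>) (normb b' f) ?x ?g"
    using ob[of "flow_rate \<omega> b a + 1"] by auto
  then interpret op_bounds \<theta> \<omega> a' b' "normb a' \<phi>" "normb b' f" ?x ?g .
  show eq: "phiDelta \<theta> \<omega> \<phi> f = egf (opcoef \<theta> \<omega> ?x ?g)"
    using phiDelta_egf assms[THEN Aspace_egf_kderiv] by simp
  show "phiDelta_term \<theta> \<omega> \<phi> f z sums phiDelta \<theta> \<omega> \<phi> f z"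
    using phiDelta_term_sums[of z] assms[THEN Aspace_egf_kderiv] eq by simp
  show "phiDelta \<theta> \<omega> \<phi> f \<in> Aspace (flow_rate \<omega> b a)"
    unfolding eq
  proof (rule egf_in_Aspace)
    show "flow_rate \<omega> b a \<ge> 0" using params small by (intro flow_rate_nonneg)
    fix r assume r: "r > flow_rate \<omega> b a"
    from ob[OF r] obtain a' b' where ob: "op_bounds \<theta> \<omega> a' b' (normb a' \<phi>) (normb b' f) ?x ?g"
      and le: "flow_rate \<omega> b' a' \<le> r" by blast
    interpret I: op_bounds \<theta> \<omega> a' b' "normb a' \<phi>" "normb b' f" ?x ?g by fact
    have "norm (opcoef \<theta> \<omega> ?x ?g l) \<le> normb a' \<phi> * normb b' f * flow_factor \<theta> \<omega> b' a' * r ^ l" for l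
      using I.nonneg I.lt1 I.MN_nonneg le
      by (intro order_trans[OF I.norm_opcoef_le] mult_left_mono power_mono flow_rate_nonneg)
         (auto simp: flow_factor_def)
    then show "\<exists>M. \<forall>l. norm (opcoef \<theta> \<omega> ?x ?g l) \<le> M * r ^ l" by blast
  qed
qed

lemma phiDelta_Laguerre:
  assumes \<phi>: "\<phi> \<in> LaguerreA a" and f: "f \<in> LaguerreA b"
  shows "phiDelta \<theta> \<omega> \<phi> f \<in> Laguerre"
proof -
  have A: "\<phi> \<in> Aspace a" "f \<in> Aspace b" "\<phi> \<in> Laguerre" "f \<in> Laguerre"
    using \<phi> f by (auto simp: LaguerreA_def)
  obtain a' b' where ab: "a' > a" "b' > b" "b' * Eexp \<omega> a' < 1"
    by (rule flow_rate_approx[OF small, of "flow_rate \<omega> b a + 1"]) (simp, rule that)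
  interpret op_bounds \<theta> \<omega> a' b' "normb a' \<phi>" "normb b' f" "\<lambda>k. kderiv k \<phi> 0" "\<lambda>k. kderiv k f 0"
    by (rule op_bounds_Aspace[OF params ab A(1,2)])
  obtain P where P: "\<And>n. P n = 0 \<or> nonpos_rooted (P n)"
    "\<And>k. (\<lambda>n. cseq (P n) k) \<longlonglongrightarrow> kderiv k \<phi> 0" "\<And>n k. norm (cseq (P n) k) \<le> norm (kderiv k \<phi> 0)"
    by (rule Laguerre_approx[OF A(3)]) (rule that)
  obtain Q where Q: "\<And>n. Q n = 0 \<or> nonpos_rooted (Q n)"
    "\<And>k. (\<lambda>n. cseq (Q n) k) \<longlonglongrightarrow> kderiv k f 0" "\<And>n k. norm (cseq (Q n) k) \<le> norm (kderiv k f 0)"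
    by (rule Laguerre_approx[OF A(4)]) (rule that)
  \<comment> \<open>Domination of the approximants makes the bounds uniform in n, as both the
    passage to the limit and the polynomial limit lemma demand.\<close>
  have ob: "op_bounds \<theta> \<omega> a' b' (normb a' \<phi>) (normb b' f) (cseq (P n)) (cseq (Q n))" for n
    using params ab order_trans[OF P(3) x_le] order_trans[OF Q(3) g_le] by unfold_locales auto
  have "egf (opcoef \<theta> \<omega> (\<lambda>k. kderiv k \<phi> 0) (\<lambda>k. kderiv k f 0)) \<in> Laguerre"
  proof (rule nonpos_rooted_limit_Laguerre)
    show "polyapp \<theta> \<omega> (P n) (Q n) = 0 \<or> nonpos_rooted (polyapp \<theta> \<omega> (P n) (Q n))" for n
    proof -
      have "(DeltaP \<theta> \<omega> ^^ k) 0 = 0" for k by (induction k) auto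
      then have "polyapp \<theta> \<omega> p 0 = 0" "polyapp \<theta> \<omega> 0 q = 0" for p q
        by (simp_all add: polyapp_def)
      with P(1)[of n] Q(1)[of n] nonpos_rooted_polyapp[OF _ _ params(1,2), of "P n" "Q n"]
      show ?thesis by metis
    qed
    show "flow_rate \<omega> b' a' \<ge> 0" using op_bounds.nonneg(4)[OF ob] ab by (intro flow_rate_nonneg) auto
    show "norm (cseq (polyapp \<theta> \<omega> (P n) (Q n)) l)
        \<le> (normb a' \<phi> * normb b' f * flow_factor \<theta> \<omega> b' a') * flow_rate \<omega> b' a' ^ l" for n l
      unfolding cseq_polyapp by (rule op_bounds.norm_opcoef_le[OF ob])
    show "(\<lambda>n. cseq (polyapp \<theta> \<omega> (P n) (Q n)) l)
        \<longlonglongrightarrow> opcoef \<theta> \<omega> (\<lambda>k. kderiv k \<phi> 0) (\<lambda>k. kderiv k f 0) l" for l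
      unfolding cseq_polyapp by (rule opcoef_tendsto[OF ob P(2) Q(2)])
  qed
  then show ?thesis by (simp add: phiDelta_Aspace(2)[OF A(1,2)])
qed

text \<open>The constant is the flow factor at the enlarged parameters; like \<open>a'\<close> and
  \<open>b'\<close> it is chosen from r alone, before the functions.\<close>

lemma phiDelta_estimate:
  assumes "r > flow_rate \<omega> b a"
  shows "\<exists>a'>a. \<exists>b'>b. \<exists>K>0. \<forall>\<phi>\<in>Aspace a. \<forall>\<phi>'\<in>Aspace a. \<forall>f\<in>Aspace b. \<forall>f'\<in>Aspace b.
    normb r (\<lambda>z. phiDelta \<theta> \<omega> \<phi> f z - phiDelta \<theta> \<omega> \<phi>' f' z)
      \<le> K * (normb a' (\<lambda>z. \<phi> z - \<phi>' z) * normb b' f + normb a' \<phi>' * normb b' (\<lambda>z. f z - f' z))"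
proof -
  obtain a' b' where ab: "a' > a" "b' > b" "b' * Eexp \<omega> a' < 1" and le: "flow_rate \<omega> b' a' \<le> r"
    by (rule flow_rate_approx[OF small assms]) (rule that)
  let ?K = "flow_factor \<theta> \<omega> b' a'"
  have K: "?K > 0" using ab by (simp add: flow_factor_def)
  have fr: "0 \<le> flow_rate \<omega> b a" "0 \<le> flow_rate \<omega> b' a'"
    using params small ab by (auto intro!: flow_rate_nonneg)
  have "normb r (\<lambda>z. phiDelta \<theta> \<omega> \<phi> f z - phiDelta \<theta> \<omega> \<phi>' f' z)
      \<le> ?K * (normb a' (\<lambda>z. \<phi> z - \<phi>' z) * normb b' f + normb a' \<phi>' * normb b' (\<lambda>z. f z - f' z))"
    if A: "\<phi> \<in> Aspace a" "\<phi>' \<in> Aspace a" "f \<in> Aspace b" "f' \<in> Aspace b" for \<phi> \<phi>' f f'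
  proof -
    let ?u = "\<lambda>z. \<phi> z - \<phi>' z" and ?v = "\<lambda>z. f z - f' z"
    let ?d = "\<lambda>h k. kderiv k h 0"
    have B: "?u \<in> Aspace a" "?v \<in> Aspace b" using A params by (auto intro: Aspace_diff)
    note ob = op_bounds_Aspace[OF params ab]
    have c: "norm (opcoef \<theta> \<omega> (?d g) (?d h) l) \<le> (normb a' g * normb b' h * ?K) * r ^ l"
      if "g \<in> Aspace a" "h \<in> Aspace b" for g h l
    proof -
      interpret op_bounds \<theta> \<omega> a' b' "normb a' g" "normb b' h" "?d g" "?d h"
        by (rule ob[OF that])
      show ?thesis
        using MN_nonneg K le fr by (intro order_trans[OF norm_opcoef_le] mult_left_mono power_mono) auto
    qed
    show ?thesis
    proof (rule normb_le)
      fix k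
      have du: "?d ?u = (\<lambda>k. ?d \<phi> k - ?d \<phi>' k)" and dv: "?d ?v = (\<lambda>k. ?d f k - ?d f' k)"
        using kderiv_diff A by blast+
      have kd: "kderiv k (phiDelta \<theta> \<omega> g h) 0 = opcoef \<theta> \<omega> (?d g) (?d h) k"
        if "g \<in> Aspace a" "h \<in> Aspace b" for g h
      proof -
        have "geom_bounded (opcoef \<theta> \<omega> (?d g) (?d h))"
          unfolding geom_bounded_def using c[OF that] K le fr op_bounds.MN_nonneg[OF ob[OF that]]
          by (intro exI[of _ "normb a' g * normb b' h * ?K"] conjI exI[of _ r]) auto
        then show ?thesis by (simp add: phiDelta_Aspace(2) that kderiv_egf_0)
      qed
      have "kderiv k (\<lambda>z. phiDelta \<theta> \<omega> \<phi> f z - phiDelta \<theta> \<omega> \<phi>' f' z) 0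
          = opcoef \<theta> \<omega> (?d \<phi>) (?d f) k - opcoef \<theta> \<omega> (?d \<phi>') (?d f') k"
        using A by (subst kderiv_diff[OF phiDelta_Aspace(3) phiDelta_Aspace(3)]) (auto simp: kd)
      also have "\<dots> = opcoef \<theta> \<omega> (?d ?u) (?d f) k + opcoef \<theta> \<omega> (?d \<phi>') (?d ?v) k"
        unfolding du dv by (rule opcoef_diff[OF ob ob]) (use A in auto)
      finally have "norm (kderiv k (\<lambda>z. phiDelta \<theta> \<omega> \<phi> f z - phiDelta \<theta> \<omega> \<phi>' f' z) 0)
          = norm (opcoef \<theta> \<omega> (?d ?u) (?d f) k + opcoef \<theta> \<omega> (?d \<phi>') (?d ?v) k)"
        by (rule arg_cong)
      also have "\<dots> \<le> (normb a' ?u * normb b' f * ?K) * r ^ k + (normb a' \<phi>' * normb b' ?v * ?K) * r ^ k"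
        using A B by (intro norm_triangle_le add_mono c)
      finally show "norm (kderiv k (\<lambda>z. phiDelta \<theta> \<omega> \<phi> f z - phiDelta \<theta> \<omega> \<phi>' f' z) 0)
          \<le> (?K * (normb a' ?u * normb b' f + normb a' \<phi>' * normb b' ?v)) * r ^ k"
        by (simp only: ring_distribs mult_ac)
    qed (use assms fr in simp)
  qed
  with ab(1,2) K show ?thesis by blast
qed

end

lemma continuous_phiDelta:
  assumes nonneg: "\<theta> \<ge> 0" "\<omega> \<ge> 0" "a \<ge> 0" "b \<ge> 0" and lt1: "b * Eexp \<omega> a < 1"
  shows "continuous_map (prod_topology (LaguerreA_top a) (LaguerreA_top b))
    (LaguerreA_top (flow_rate \<omega> b a)) (\<lambda>(\<phi>, f). phiDelta \<theta> \<omega> \<phi> f)"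
proof -
  let ?c = "flow_rate \<omega> b a" and ?F = "\<lambda>(\<phi>, f). phiDelta \<theta> \<omega> \<phi> f"
  note Asp = phiDelta_Aspace(3)[OF nonneg lt1]
  have LA: "phiDelta \<theta> \<omega> \<phi> f \<in> LaguerreA ?c" if "\<phi> \<in> LaguerreA a" "f \<in> LaguerreA b" for \<phi> f
    using phiDelta_Laguerre[OF nonneg lt1 that] Asp that by (simp add: LaguerreA_def)
  have nbhds: "\<exists>U V. openin (LaguerreA_top a) U \<and> openin (LaguerreA_top b) V \<and> \<phi>' \<in> U \<and> f' \<in> V
      \<and> (\<forall>\<phi>\<in>U. \<forall>f\<in>V. phiDelta \<theta> \<omega> \<phi> f \<in> W)"
    if W: "openin (Atop ?c) W" and mem: "\<phi>' \<in> LaguerreA a" "f' \<in> LaguerreA b" "phiDelta \<theta> \<omega> \<phi>' f' \<in> W"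
    for W \<phi>' f'
  proof -
    have A: "\<phi>' \<in> Aspace a" "f' \<in> Aspace b" using mem by (auto simp: LaguerreA_def)
    from W mem(3) obtain B e where B: "finite B" "B \<subseteq> {?c<..}" "e > 0"
      and BW: "{g \<in> Aspace ?c. \<forall>r\<in>B. normb r (\<lambda>z. g z - phiDelta \<theta> \<omega> \<phi>' f' z) < e} \<subseteq> W"
      unfolding openin_Atop by blast
    define close where "close = (\<lambda>r U V. \<forall>\<phi>\<in>U. \<forall>f\<in>V.
        normb r (\<lambda>z. phiDelta \<theta> \<omega> \<phi> f z - phiDelta \<theta> \<omega> \<phi>' f' z) < e)"
    have "\<exists>U V. openin (Atop a) U \<and> openin (Atop b) V \<and> \<phi>' \<in> U \<and> f' \<in> V \<and> close r U V" if r: "r \<in> B" for r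
    proof -
      from r B(2) have "r > ?c" by auto
      from phiDelta_estimate[OF nonneg lt1 this] obtain a' b' K where ab: "a' > a" "b' > b" "K > 0"
        and est0: "\<forall>\<phi>\<in>Aspace a. \<forall>\<phi>'\<in>Aspace a. \<forall>f\<in>Aspace b. \<forall>f'\<in>Aspace b.
          normb r (\<lambda>z. phiDelta \<theta> \<omega> \<phi> f z - phiDelta \<theta> \<omega> \<phi>' f' z)
          \<le> K * (normb a' (\<lambda>z. \<phi> z - \<phi>' z) * normb b' f + normb a' \<phi>' * normb b' (\<lambda>z. f z - f' z))"
        by (elim exE conjE) (rule that)
      note est = est0[rule_format, OF _ A(1) _ A(2)]
      \<comment> \<open>For \<delta> <= 1 the bracket in the estimate is at most \<delta> (|f'| + 1)
        + |\<phi>'| \<delta> = \<delta> M, in the norms at \<open>b'\<close> and \<open>a'\<close>.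
        The denominator contains M + 1 so that the final inequality is strict.\<close>
      define M where "M = normb b' f' + 1 + normb a' \<phi>'"
      define \<delta> where "\<delta> = min 1 (e / (K * (M + 1)))"
      have n0: "0 \<le> normb a' \<phi>'" "0 \<le> normb b' f'"
        using A ab nonneg by (auto intro!: normb_nonneg)
      then have M: "M > 0" by (simp add: M_def)
      have \<delta>: "\<delta> > 0" "\<delta> \<le> 1" using M ab B(3) by (auto simp: \<delta>_def)
      have "K * (\<delta> * M) < K * (\<delta> * (M + 1))" using \<delta> ab M by simp
      also have "\<dots> \<le> K * ((e / (K * (M + 1))) * (M + 1))"
        using ab M by (intro mult_left_mono mult_right_mono) (auto simp: \<delta>_def)
      also have "\<dots> = e" using ab M by simp
      finally have Ke: "K * (\<delta> * M) < e" .
      let ?U = "{\<phi> \<in> Aspace a. normb a' (\<lambda>z. \<phi> z - \<phi>' z) < \<delta>}"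
      let ?V = "{f \<in> Aspace b. normb b' (\<lambda>z. f z - f' z) < \<delta>}"
      have "close r ?U ?V"
        unfolding close_def
      proof (intro ballI)
        fix \<phi> f assume U: "\<phi> \<in> ?U" and V: "f \<in> ?V"
        have dn: "0 \<le> normb a' (\<lambda>z. \<phi> z - \<phi>' z)" "0 \<le> normb b' (\<lambda>z. f z - f' z)" "0 \<le> normb b' f"
          using normb_nonneg[OF Aspace_diff[OF nonneg(3) _ A(1)] ab(1)]
            normb_nonneg[OF Aspace_diff[OF nonneg(4) _ A(2)] ab(2)] normb_nonneg[OF _ ab(2)] U V ab nonneg by auto
        \<comment> \<open>The factor \<open>normb b' f\<close> varies with f; near f' it is bounded
          by \<open>normb b' f' + 1\<close>.\<close>
        have "normb b' f \<le> normb b' (\<lambda>z. f z - f' z) + normb b' f'"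
        proof (rule normb_le)
          fix k
          have "norm (kderiv k f 0) \<le> norm (kderiv k (\<lambda>z. f z - f' z) 0) + norm (kderiv k f' 0)"
            using V A norm_triangle_sub[of "kderiv k f 0" "kderiv k f' 0"]
            by (simp add: kderiv_diff[where a = b] add.commute)
          also have "\<dots> \<le> normb b' (\<lambda>z. f z - f' z) * b' ^ k + normb b' f' * b' ^ k"
            using V A ab nonneg by (intro add_mono Aspace_normb_bound[where a = b] Aspace_diff) auto
          finally show "norm (kderiv k f 0) \<le> (normb b' (\<lambda>z. f z - f' z) + normb b' f') * b' ^ k"
            by (simp only: ring_distribs)
        qed (use ab nonneg in simp)
        then have f1: "normb b' f \<le> normb b' f' + 1" using V \<delta> by auto
        have "normb a' (\<lambda>z. \<phi> z - \<phi>' z) * normb b' f + normb a' \<phi>' * normb b' (\<lambda>z. f z - f' z)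
            \<le> \<delta> * (normb b' f' + 1) + normb a' \<phi>' * \<delta>"
          using U V f1 dn n0 \<delta> by (intro add_mono mult_mono) auto
        also have "\<dots> = \<delta> * M" by (simp add: M_def algebra_simps)
        finally have "K * (normb a' (\<lambda>z. \<phi> z - \<phi>' z) * normb b' f + normb a' \<phi>' * normb b' (\<lambda>z. f z - f' z)) \<le> K * (\<delta> * M)"
          using ab by (intro mult_left_mono) auto
        with est[of \<phi> f] U V Ke
        show "normb r (\<lambda>z. phiDelta \<theta> \<omega> \<phi> f z - phiDelta \<theta> \<omega> \<phi>' f' z) < e" by simp
      qed
      moreover have "\<phi>' \<in> ?U" "f' \<in> ?V"
        using A \<delta>(1) normb_0[of a' \<phi>'] normb_0[of b' f'] ab nonneg by auto
      moreover have "openin (Atop a) ?U" "openin (Atop b) ?V"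
        using A ab nonneg by (auto intro: openin_Atop_ball)
      ultimately have "openin (Atop a) ?U \<and> openin (Atop b) ?V \<and> \<phi>' \<in> ?U \<and> f' \<in> ?V \<and> close r ?U ?V"
        by (intro conjI)
      then show ?thesis by (intro exI)
    qed
    then obtain U V where UV: "\<And>r. r \<in> B \<Longrightarrow> openin (Atop a) (U r)" "\<And>r. r \<in> B \<Longrightarrow> openin (Atop b) (V r)"
      "\<And>r. r \<in> B \<Longrightarrow> \<phi>' \<in> U r" "\<And>r. r \<in> B \<Longrightarrow> f' \<in> V r"
      and close: "\<And>r. r \<in> B \<Longrightarrow> close r (U r) (V r)"
      by metis
    \<comment> \<open>Intersecting with the whole space covers an empty \<open>B\<close>, for which
      the intersection of the family would be the set of all functions.\<close>
    define U' where "U' = topspace (Atop a) \<inter> \<Inter> (U ` B)"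
    define V' where "V' = topspace (Atop b) \<inter> \<Inter> (V ` B)"
    have opn: "openin (Atop a) U'" "openin (Atop b) V'"
      unfolding U'_def V'_def using B(1) UV(1,2) by (auto intro!: openin_Int_Inter)
    show ?thesis
    proof (rule exI[of _ "LaguerreA a \<inter> U'"], rule exI[of _ "LaguerreA b \<inter> V'"], intro conjI ballI)
      show "openin (LaguerreA_top a) (LaguerreA a \<inter> U')" "openin (LaguerreA_top b) (LaguerreA b \<inter> V')"
        unfolding LaguerreA_top_def using opn by (auto intro: openin_subtopology_Int2)
      show "\<phi>' \<in> LaguerreA a \<inter> U'" "f' \<in> LaguerreA b \<inter> V'"
        using mem A UV(3,4) by (auto simp: U'_def V'_def topspace_Atop)
      fix \<phi> f assume "\<phi> \<in> LaguerreA a \<inter> U'" "f \<in> LaguerreA b \<inter> V'"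
      then have "\<phi> \<in> Aspace a" "f \<in> Aspace b" and "\<And>r. r \<in> B \<Longrightarrow> \<phi> \<in> U r \<and> f \<in> V r"
        by (auto simp: LaguerreA_def U'_def V'_def)
      then have "\<forall>r\<in>B. normb r (\<lambda>z. phiDelta \<theta> \<omega> \<phi> f z - phiDelta \<theta> \<omega> \<phi>' f' z) < e"
        "phiDelta \<theta> \<omega> \<phi> f \<in> Aspace ?c"
        using close Asp unfolding close_def by simp_all
      then show "phiDelta \<theta> \<omega> \<phi> f \<in> W" by (intro subsetD[OF BW]) simp
    qed
  qed
  show ?thesis
    unfolding continuous_map_def topspace_prod_topology topspace_LaguerreA_top
  proof (intro conjI allI impI)
    show "?F \<in> LaguerreA a \<times> LaguerreA b \<rightarrow> LaguerreA ?c" using LA by auto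
    fix U assume "openin (LaguerreA_top ?c) U"
    then obtain W where W: "openin (Atop ?c) W" "U = W \<inter> LaguerreA ?c"
      by (auto simp: LaguerreA_top_def openin_subtopology)
    show "openin (prod_topology (LaguerreA_top a) (LaguerreA_top b))
        {x \<in> LaguerreA a \<times> LaguerreA b. ?F x \<in> U}"
      unfolding openin_prod_topology_alt
    proof (intro allI impI)
      fix \<phi>' f' assume "(\<phi>', f') \<in> {x \<in> LaguerreA a \<times> LaguerreA b. ?F x \<in> U}"
      then have mem: "\<phi>' \<in> LaguerreA a" "f' \<in> LaguerreA b" "phiDelta \<theta> \<omega> \<phi>' f' \<in> W"
        using W by auto
      from nbhds[OF W(1) mem] obtain S T where ST: "openin (LaguerreA_top a) S" "openin (LaguerreA_top b) T"
        "\<phi>' \<in> S" "f' \<in> T" "\<And>\<phi> f. \<phi> \<in> S \<Longrightarrow> f \<in> T \<Longrightarrow> phiDelta \<theta> \<omega> \<phi> f \<in> W" by blast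
      have "S \<subseteq> LaguerreA a" "T \<subseteq> LaguerreA b"
        using ST(1,2) openin_subset topspace_LaguerreA_top by blast+
      then have "S \<times> T \<subseteq> {x \<in> LaguerreA a \<times> LaguerreA b. ?F x \<in> U}"
        using ST(5) W(2) by (auto intro!: LA)
      with ST show "\<exists>S T. openin (LaguerreA_top a) S \<and> openin (LaguerreA_top b) T \<and> \<phi>' \<in> S \<and> f' \<in> T
          \<and> S \<times> T \<subseteq> {x \<in> LaguerreA a \<times> LaguerreA b. ?F x \<in> U}" by blast
    qed
  qed
qed

theorem theorem3:
  fixes \<theta> \<omega> a b :: real
  assumes "\<theta> \<ge> 0" and "\<omega> \<ge> 0" and "a \<ge> 0" and "b \<ge> 0"
    and "b * Eexp \<omega> a < 1"
  defines "c \<equiv> b * exp (a * \<omega>) / (1 - b * Eexp \<omega> a)"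
  shows "(\<forall>\<phi>\<in>LaguerreA a. \<forall>f\<in>LaguerreA b. \<forall>z.
            summable (phiDelta_term \<theta> \<omega> \<phi> f z))
       \<and> (\<forall>\<phi>\<in>LaguerreA a. \<forall>f\<in>LaguerreA b. phiDelta \<theta> \<omega> \<phi> f \<in> LaguerreA c)
       \<and> continuous_map (prod_topology (LaguerreA_top a) (LaguerreA_top b)) (LaguerreA_top c)
            (\<lambda>(\<phi>, f). phiDelta \<theta> \<omega> \<phi> f)"
proof -
  note params = assms(1-5)
  have c: "c = flow_rate \<omega> b a" by (simp add: c_def flow_rate_def)
  show ?thesis
    unfolding c
  proof (intro conjI ballI allI continuous_phiDelta params)
    fix \<phi> f assume *: "\<phi> \<in> LaguerreA a" "f \<in> LaguerreA b"
    then have A: "\<phi> \<in> Aspace a" "f \<in> Aspace b" by (auto simp: LaguerreA_def)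
    show "summable (phiDelta_term \<theta> \<omega> \<phi> f z)" for z
      using phiDelta_Aspace(1)[OF params A] by (rule sums_summable)
    show "phiDelta \<theta> \<omega> \<phi> f \<in> LaguerreA (flow_rate \<omega> b a)"
      using phiDelta_Laguerre[OF params *] phiDelta_Aspace(3)[OF params A] by (simp add: LaguerreA_def)
  qed
qed

end
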